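(* Every downset-finite module over a polyhedral partially ordered group admits a primary decomposition.
   Context: Fix a field $\Bbbk$. A partially ordered group is an abelian group $Q$ generated by a submonoid $Q_+$ (the positive cone) with trivial unit group, ordered by $q\preceq q'\iff q'-q\in Q_+$. A face of $Q_+$ is a submonoid $\sigma\subseteq Q_+$ such that $Q_+\smallsetminus\sigma$ is an ideal of the monoid $Q_+$; $Q$ is polyhedral if it has only finitely many faces. A $Q$-module is a $Q$-graded $\Bbbk$-vector space $M=\bigoplus_{q\in Q}M_q$ with functorial structure morphisms $M_q\to M_{q'}$ for $q\preceq q'$; equivalently, a $Q$-graded module over the monoid algebra $\Bbbk[Q_+]$. For a downset $D\subseteq Q$ (closed under going down), the downset module $\Bbbk[D]$ is the quotient of $\Bbbk[Q]$ with $\Bbbk$ in degrees from $D$ and $0$ elsewhere, with identity structure maps within $D$. A downset hull of $M$ is an injection $M\hookrightarrow\bigoplus_{j\in J}E_j$ with each $E_j$ a downset module; it is finite if $J$ is finite. $M$ is downset-finite if it admits a finite downset hull. The localization of $M$ along a face $\tau$ is $M_\tau=M\otimes_{\Bbbk[Q_+]}\Bbbk[Q_++\mathbb Z\tau]$, where $\mathbb Z\tau$ is the subgroup generated by $\tau$. The submodule globally supported on $\tau$ is $\Gamma_\tau M=\bigcap_{\tau'\not\subseteq\tau}\ker(M\to M_{\tau'})$, over faces $\tau'$. A module $M$ is coprimary if for some face $\tau$ the localization map $M\to M_\tau$ is injective and $\Gamma_\tau M_\tau$ is an essential submodule of $M_\tau$: every nonzero submodule of $M_\tau$ intersects it nontrivially.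 A primary decomposition of $M$ is an injection $M\hookrightarrow\bigoplus_{i=1}^r M/M_i$ into a (finite) direct sum of coprimary quotients $M/M_i$. *)

theory Defs
  imports "HOL-Algebra.Module" "HOL-Algebra.AbelCoset" "HOL-Computational_Algebra.Group_Closure"
begin

section \<open>Partially ordered groups\<close>

definition po_le :: "'q::ab_group_add set \<Rightarrow> 'q \<Rightarrow> 'q \<Rightarrow> bool" where
  "po_le Qp q q' \<longleftrightarrow> q' - q \<in> Qp"

locale po_group =
  fixes Qp :: "'q::ab_group_add set"
  assumes zero_mem: "0 \<in> Qp"
    and add_mem: "\<lbrakk>x \<in> Qp; y \<in> Qp\<rbrakk> \<Longrightarrow> x + y \<in> Qp"
    and trivial_units: "\<lbrakk>x \<in> Qp; - x \<in> Qp\<rbrakk> \<Longrightarrow> x = 0"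
    and generates: "group_closure Qp = UNIV"

text \<open>The complement of a face may be the empty ideal, so \<open>Qp\<close> is always a face.\<close>

definition face :: "'q::ab_group_add set \<Rightarrow> 'q set \<Rightarrow> bool" where
  "face Qp \<sigma> \<longleftrightarrow> \<sigma> \<subseteq> Qp \<and> 0 \<in> \<sigma> \<and> (\<forall>x\<in>\<sigma>. \<forall>y\<in>\<sigma>. x + y \<in> \<sigma>) \<and>
     (\<forall>x\<in>Qp - \<sigma>. \<forall>y\<in>Qp. x + y \<in> Qp - \<sigma>)"

locale polyhedral_po_group = po_group +
  assumes finite_faces: "finite {\<sigma>. face Qp \<sigma>}"

definition downset :: "'q::ab_group_add set \<Rightarrow> 'q set \<Rightarrow> bool" where
  "downset Qp D \<longleftrightarrow> (\<forall>q q'. po_le Qp q q' \<longrightarrow> q' \<in> D \<longrightarrow> q \<in> D)"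

definition face_cone :: "'q::ab_group_add set \<Rightarrow> 'q set \<Rightarrow> 'q set" where
  "face_cone Qp \<tau> = {p + z |p z. p \<in> Qp \<and> z \<in> group_closure \<tau>}"


section \<open>Vector spaces\<close>

text \<open>
  Vector spaces over the field \<open>K\<close> are modules in the sense of HOL-Algebra.  The type of module
  records extends that of rings; the fields \<open>mult\<close> and \<open>one\<close> are irrelevant and left undefined.
\<close>

definition vs_hom ::
  "('k, 'r) ring_scheme \<Rightarrow> ('k, 'v, 'a) module_scheme \<Rightarrow> ('k, 'w, 'b) module_scheme \<Rightarrow> ('v \<Rightarrow> 'w) set"
where
  "vs_hom K V W = {f. f \<in> carrier V \<rightarrow> carrier W \<and>
     (\<forall>x\<in>carrier V. \<forall>y\<in>carrier V. f (x \<oplus>\<^bsub>V\<^esub> y) = f x \<oplus>\<^bsub>W\<^esub> f y) \<and>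
     (\<forall>c\<in>carrier K. \<forall>x\<in>carrier V. f (c \<odot>\<^bsub>V\<^esub> x) = c \<odot>\<^bsub>W\<^esub> f x)}"

definition vs_zero :: "('k, 'r) ring_scheme \<Rightarrow> ('k, 'k) module" where
  "vs_zero K = \<lparr>carrier = {\<zero>\<^bsub>K\<^esub>}, mult = undefined, one = undefined,
     zero = \<zero>\<^bsub>K\<^esub>, add = add K, smult = mult K\<rparr>"

definition vs_self :: "('k, 'r) ring_scheme \<Rightarrow> ('k, 'k) module" where
  "vs_self K = \<lparr>carrier = carrier K, mult = undefined, one = undefined,
     zero = \<zero>\<^bsub>K\<^esub>, add = add K, smult = mult K\<rparr>"

definition vs_dsum :: "'j set \<Rightarrow> ('j \<Rightarrow> ('k, 'v) module) \<Rightarrow> ('k, 'j \<Rightarrow> 'v) module" where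
  "vs_dsum J V = \<lparr>
     carrier = {f \<in> (\<Pi>\<^sub>E j\<in>J. carrier (V j)). finite {j \<in> J. f j \<noteq> \<zero>\<^bsub>V j\<^esub>}},
     mult = undefined, one = undefined,
     zero = (\<lambda>j\<in>J. \<zero>\<^bsub>V j\<^esub>),
     add = (\<lambda>f g. \<lambda>j\<in>J. f j \<oplus>\<^bsub>V j\<^esub> g j),
     smult = (\<lambda>c f. \<lambda>j\<in>J. c \<odot>\<^bsub>V j\<^esub> f j)\<rparr>"

definition vs_quot :: "('k, 'v) module \<Rightarrow> 'v set \<Rightarrow> ('k, 'v set) module" where
  "vs_quot V N = \<lparr>
     carrier = a_rcosets\<^bsub>V\<^esub> N,
     mult = undefined, one = undefined,
     zero = N,
     add = set_add V,
     smult = (\<lambda>c X. \<Union>x\<in>X. N +>\<^bsub>V\<^esub> (c \<odot>\<^bsub>V\<^esub> x))\<rparr>"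

definition vs_span :: "('k, 'r) ring_scheme \<Rightarrow> ('k, 'v) module \<Rightarrow> 'v set \<Rightarrow> 'v set" where
  "vs_span K V A = \<Inter>{H. submodule H K V \<and> A \<subseteq> H}"


section \<open>Modules graded by a partially ordered group\<close>

text \<open>
  \<open>qpart M q\<close> is the component \<open>M\<^sub>q\<close>, and \<open>qmor M q q'\<close> the structure
  morphism \<open>M\<^sub>q \<rightarrow> M\<^sub>q\<^sub>'\<close>, meaningful only for \<open>q \<preceq> q'\<close>.
\<close>

record ('q, 'k, 'v) qmod =
  qpart :: "'q \<Rightarrow> ('k, 'v) module"
  qmor :: "'q \<Rightarrow> 'q \<Rightarrow> 'v \<Rightarrow> 'v"

definition qmodule ::
  "('k, 'r) ring_scheme \<Rightarrow> 'q::ab_group_add set \<Rightarrow> ('q, 'k, 'v) qmod \<Rightarrow> bool"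
where
  "qmodule K Qp M \<longleftrightarrow>
     (\<forall>q. module K (qpart M q)) \<and>
     (\<forall>q q'. po_le Qp q q' \<longrightarrow> qmor M q q' \<in> vs_hom K (qpart M q) (qpart M q')) \<and>
     (\<forall>q. \<forall>x\<in>carrier (qpart M q). qmor M q q x = x) \<and>
     (\<forall>q q' q''. po_le Qp q q' \<longrightarrow> po_le Qp q' q'' \<longrightarrow>
        (\<forall>x\<in>carrier (qpart M q). qmor M q' q'' (qmor M q q' x) = qmor M q q'' x))"

definition qhom ::
  "('k, 'r) ring_scheme \<Rightarrow> 'q::ab_group_add set \<Rightarrow> ('q, 'k, 'v) qmod \<Rightarrow> ('q, 'k, 'w) qmod \<Rightarrow>
     ('q \<Rightarrow> 'v \<Rightarrow> 'w) \<Rightarrow> bool"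
where
  "qhom K Qp M N \<phi> \<longleftrightarrow>
     (\<forall>q. \<phi> q \<in> vs_hom K (qpart M q) (qpart N q)) \<and>
     (\<forall>q q'. po_le Qp q q' \<longrightarrow>
        (\<forall>x\<in>carrier (qpart M q). \<phi> q' (qmor M q q' x) = qmor N q q' (\<phi> q x)))"

definition qinjective :: "('q, 'k, 'v) qmod \<Rightarrow> ('q \<Rightarrow> 'v \<Rightarrow> 'w) \<Rightarrow> bool" where
  "qinjective M \<phi> \<longleftrightarrow> (\<forall>q. inj_on (\<phi> q) (carrier (qpart M q)))"

definition qsubmodule ::
  "('k, 'r) ring_scheme \<Rightarrow> 'q::ab_group_add set \<Rightarrow> ('q \<Rightarrow> 'v set) \<Rightarrow> ('q, 'k, 'v) qmod \<Rightarrow> bool"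
where
  "qsubmodule K Qp N M \<longleftrightarrow>
     (\<forall>q. submodule (N q) K (qpart M q)) \<and>
     (\<forall>q q'. po_le Qp q q' \<longrightarrow> qmor M q q' ` N q \<subseteq> N q')"

definition essential_qsubmodule ::
  "('k, 'r) ring_scheme \<Rightarrow> 'q::ab_group_add set \<Rightarrow> ('q \<Rightarrow> 'v set) \<Rightarrow> ('q, 'k, 'v) qmod \<Rightarrow> bool"
where
  "essential_qsubmodule K Qp N M \<longleftrightarrow>
     qsubmodule K Qp N M \<and>
     (\<forall>L. qsubmodule K Qp L M \<longrightarrow> (\<exists>q. L q \<noteq> {\<zero>\<^bsub>qpart M q\<^esub>}) \<longrightarrow>
        (\<exists>q. L q \<inter> N q \<noteq> {\<zero>\<^bsub>qpart M q\<^esub>}))"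

definition qdsum :: "'j set \<Rightarrow> ('j \<Rightarrow> ('q, 'k, 'v) qmod) \<Rightarrow> ('q, 'k, 'j \<Rightarrow> 'v) qmod" where
  "qdsum J E = \<lparr>
     qpart = (\<lambda>q. vs_dsum J (\<lambda>j. qpart (E j) q)),
     qmor = (\<lambda>q q' f. \<lambda>j\<in>J. qmor (E j) q q' (f j))\<rparr>"

definition qquot :: "('q, 'k, 'v) qmod \<Rightarrow> ('q \<Rightarrow> 'v set) \<Rightarrow> ('q, 'k, 'v set) qmod" where
  "qquot M N = \<lparr>
     qpart = (\<lambda>q. vs_quot (qpart M q) (N q)),
     qmor = (\<lambda>q q' X. \<Union>x\<in>X. N q' +>\<^bsub>qpart M q'\<^esub> qmor M q q' x)\<rparr>"

definition qproj :: "('q, 'k, 'v) qmod \<Rightarrow> ('q \<Rightarrow> 'v set) \<Rightarrow> 'q \<Rightarrow> 'v \<Rightarrow> 'v set" where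
  "qproj M N q x = N q +>\<^bsub>qpart M q\<^esub> x"

text \<open>
  \<open>indicator_qmod K A\<close> has \<open>K\<close> in the degrees from \<open>A\<close> and \<open>0\<close> elsewhere, with identity structure
  morphisms within \<open>A\<close>.  For a downset \<open>A\<close> it is the downset module \<open>K[A]\<close>, a quotient of \<open>K[Q]\<close>;
  for \<open>A\<close> closed under adding \<open>Qp\<close>, such as \<open>face_cone Qp \<tau>\<close>, it is the submodule \<open>K[A]\<close> of
  \<open>K[Q]\<close>.
\<close>

definition indicator_qmod :: "('k, 'r) ring_scheme \<Rightarrow> 'q set \<Rightarrow> ('q, 'k, 'k) qmod" where
  "indicator_qmod K A = \<lparr>
     qpart = (\<lambda>q. if q \<in> A then vs_self K else vs_zero K),
     qmor = (\<lambda>q q' x. if q \<in> A \<and> q' \<in> A then x else \<zero>\<^bsub>K\<^esub>)\<rparr>"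


section \<open>Downset hulls\<close>

definition downset_hull ::
  "('k, 'r) ring_scheme \<Rightarrow> 'q::ab_group_add set \<Rightarrow> ('q, 'k, 'v) qmod \<Rightarrow>
     'j set \<Rightarrow> ('j \<Rightarrow> 'q set) \<Rightarrow> ('q \<Rightarrow> 'v \<Rightarrow> 'j \<Rightarrow> 'k) \<Rightarrow> bool"
where
  "downset_hull K Qp M J D \<phi> \<longleftrightarrow>
     (\<forall>j\<in>J. downset Qp (D j)) \<and>
     qhom K Qp M (qdsum J (\<lambda>j. indicator_qmod K (D j))) \<phi> \<and>
     qinjective M \<phi>"

text \<open>A finite index set may be taken to consist of natural numbers.\<close>

definition downset_finite ::
  "('k, 'r) ring_scheme \<Rightarrow> 'q::ab_group_add set \<Rightarrow> ('q, 'k, 'v) qmod \<Rightarrow> bool"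
where
  "downset_finite K Qp M \<longleftrightarrow>
     (\<exists>(J :: nat set) D \<phi>. finite J \<and> downset_hull K Qp M J D \<phi>)"


section \<open>Tensor products over the monoid algebra\<close>

text \<open>
  The degree \<open>q\<close> part of \<open>M \<otimes> N\<close>, over the monoid algebra \<open>K[Qp]\<close>, is the
  vector space freely generated by the symbols \<open>x \<otimes> y\<close> with \<open>x\<close> in \<open>M\<^sub>a\<close>, \<open>y\<close> in \<open>N\<^sub>b\<close> and
  \<open>a + b = q\<close>, encoded as tuples \<open>(a, x, b, y)\<close>, modulo bilinearity over \<open>K\<close> and the relations
  \<open>(t\<^sup>p x) \<otimes> y = x \<otimes> (t\<^sup>p y)\<close> for the monomials \<open>t\<^sup>p\<close> of \<open>K[Qp]\<close>, which act by the structure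
  morphisms.
\<close>

type_synonym ('q, 'v, 'w) tgen = "'q \<times> 'v \<times> 'q \<times> 'w"

definition tgens ::
  "('q::ab_group_add, 'k, 'v) qmod \<Rightarrow> ('q, 'k, 'w) qmod \<Rightarrow> 'q \<Rightarrow> ('q, 'v, 'w) tgen set"
where
  "tgens M N q = {(a, x, b, y). a + b = q \<and> x \<in> carrier (qpart M a) \<and> y \<in> carrier (qpart N b)}"

definition tfree ::
  "('k, 'r) ring_scheme \<Rightarrow> ('q::ab_group_add, 'k, 'v) qmod \<Rightarrow> ('q, 'k, 'w) qmod \<Rightarrow> 'q \<Rightarrow>
     ('k, ('q, 'v, 'w) tgen \<Rightarrow> 'k) module"
where
  "tfree K M N q = vs_dsum (tgens M N q) (\<lambda>_. vs_self K)"

definition tbasis ::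
  "('k, 'r) ring_scheme \<Rightarrow> ('q::ab_group_add, 'k, 'v) qmod \<Rightarrow> ('q, 'k, 'w) qmod \<Rightarrow> 'q \<Rightarrow>
     ('q, 'v, 'w) tgen \<Rightarrow> ('q, 'v, 'w) tgen \<Rightarrow> 'k"
where
  "tbasis K M N q g = (\<lambda>h\<in>tgens M N q. if h = g then \<one>\<^bsub>K\<^esub> else \<zero>\<^bsub>K\<^esub>)"

inductive_set trels ::
  "('k, 'r) ring_scheme \<Rightarrow> 'q::ab_group_add set \<Rightarrow> ('q, 'k, 'v) qmod \<Rightarrow> ('q, 'k, 'w) qmod \<Rightarrow> 'q \<Rightarrow>
     (('q, 'v, 'w) tgen \<Rightarrow> 'k) set"
  for K Qp M N q
where
  add_left:
    "\<lbrakk>a + b = q; x \<in> carrier (qpart M a); x' \<in> carrier (qpart M a); y \<in> carrier (qpart N b)\<rbrakk> \<Longrightarrow>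
     tbasis K M N q (a, x \<oplus>\<^bsub>qpart M a\<^esub> x', b, y) \<ominus>\<^bsub>tfree K M N q\<^esub>
       (tbasis K M N q (a, x, b, y) \<oplus>\<^bsub>tfree K M N q\<^esub> tbasis K M N q (a, x', b, y))
     \<in> trels K Qp M N q"
| add_right:
    "\<lbrakk>a + b = q; x \<in> carrier (qpart M a); y \<in> carrier (qpart N b); y' \<in> carrier (qpart N b)\<rbrakk> \<Longrightarrow>
     tbasis K M N q (a, x, b, y \<oplus>\<^bsub>qpart N b\<^esub> y') \<ominus>\<^bsub>tfree K M N q\<^esub>
       (tbasis K M N q (a, x, b, y) \<oplus>\<^bsub>tfree K M N q\<^esub> tbasis K M N q (a, x, b, y'))
     \<in> trels K Qp M N q"
| smult_left:
    "\<lbrakk>a + b = q; x \<in> carrier (qpart M a); y \<in> carrier (qpart N b); c \<in> carrier K\<rbrakk> \<Longrightarrow>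
     tbasis K M N q (a, c \<odot>\<^bsub>qpart M a\<^esub> x, b, y) \<ominus>\<^bsub>tfree K M N q\<^esub>
       (c \<odot>\<^bsub>tfree K M N q\<^esub> tbasis K M N q (a, x, b, y))
     \<in> trels K Qp M N q"
| smult_right:
    "\<lbrakk>a + b = q; x \<in> carrier (qpart M a); y \<in> carrier (qpart N b); c \<in> carrier K\<rbrakk> \<Longrightarrow>
     tbasis K M N q (a, x, b, c \<odot>\<^bsub>qpart N b\<^esub> y) \<ominus>\<^bsub>tfree K M N q\<^esub>
       (c \<odot>\<^bsub>tfree K M N q\<^esub> tbasis K M N q (a, x, b, y))
     \<in> trels K Qp M N q"
| balanced:
    "\<lbrakk>p \<in> Qp; a + p + b = q; x \<in> carrier (qpart M a); y \<in> carrier (qpart N b)\<rbrakk> \<Longrightarrow>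
     tbasis K M N q (a + p, qmor M a (a + p) x, b, y) \<ominus>\<^bsub>tfree K M N q\<^esub>
       tbasis K M N q (a, x, b + p, qmor N b (b + p) y)
     \<in> trels K Qp M N q"

definition tker ::
  "('k, 'r) ring_scheme \<Rightarrow> 'q::ab_group_add set \<Rightarrow> ('q, 'k, 'v) qmod \<Rightarrow> ('q, 'k, 'w) qmod \<Rightarrow> 'q \<Rightarrow>
     (('q, 'v, 'w) tgen \<Rightarrow> 'k) set"
where
  "tker K Qp M N q = vs_span K (tfree K M N q) (trels K Qp M N q)"

text \<open>Multiplication by \<open>t\<^sup>p\<close> for \<open>p = q' - q\<close>: the linear extension of
  \<open>x \<otimes> y \<mapsto> (t\<^sup>p x) \<otimes> y\<close>.\<close>

definition tpush ::
  "('k, 'r) ring_scheme \<Rightarrow> ('q::ab_group_add, 'k, 'v) qmod \<Rightarrow> ('q, 'k, 'w) qmod \<Rightarrow> 'q \<Rightarrow> 'q \<Rightarrow>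
     (('q, 'v, 'w) tgen \<Rightarrow> 'k) \<Rightarrow> ('q, 'v, 'w) tgen \<Rightarrow> 'k"
where
  "tpush K M N q q' f =
     (\<Oplus>\<^bsub>tfree K M N q'\<^esub> g \<in> {g \<in> tgens M N q. f g \<noteq> \<zero>\<^bsub>K\<^esub>}.
        f g \<odot>\<^bsub>tfree K M N q'\<^esub>
          (case g of (a, x, b, y) \<Rightarrow>
             tbasis K M N q' (a + (q' - q), qmor M a (a + (q' - q)) x, b, y)))"

definition qtensor ::
  "('k, 'r) ring_scheme \<Rightarrow> 'q::ab_group_add set \<Rightarrow> ('q, 'k, 'v) qmod \<Rightarrow> ('q, 'k, 'w) qmod \<Rightarrow>
     ('q, 'k, (('q, 'v, 'w) tgen \<Rightarrow> 'k) set) qmod"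
where
  "qtensor K Qp M N = \<lparr>
     qpart = (\<lambda>q. vs_quot (tfree K M N q) (tker K Qp M N q)),
     qmor = (\<lambda>q q' X. \<Union>f\<in>X. tker K Qp M N q' +>\<^bsub>tfree K M N q'\<^esub> tpush K M N q q' f)\<rparr>"


section \<open>Localization, support, and primary decomposition\<close>

definition localization ::
  "('k, 'r) ring_scheme \<Rightarrow> 'q::ab_group_add set \<Rightarrow> 'q set \<Rightarrow> ('q, 'k, 'v) qmod \<Rightarrow>
     ('q, 'k, (('q, 'v, 'k) tgen \<Rightarrow> 'k) set) qmod"
where
  "localization K Qp \<tau> M = qtensor K Qp M (indicator_qmod K (face_cone Qp \<tau>))"

text \<open>The localization map \<open>x \<mapsto> x \<otimes> 1\<close>.\<close>

definition loc_map ::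
  "('k, 'r) ring_scheme \<Rightarrow> 'q::ab_group_add set \<Rightarrow> 'q set \<Rightarrow> ('q, 'k, 'v) qmod \<Rightarrow> 'q \<Rightarrow> 'v \<Rightarrow>
     (('q, 'v, 'k) tgen \<Rightarrow> 'k) set"
where
  "loc_map K Qp \<tau> M q x =
     (let N = indicator_qmod K (face_cone Qp \<tau>)
      in tker K Qp M N q +>\<^bsub>tfree K M N q\<^esub> tbasis K M N q (q, x, 0, \<one>\<^bsub>K\<^esub>))"

definition global_support ::
  "('k, 'r) ring_scheme \<Rightarrow> 'q::ab_group_add set \<Rightarrow> 'q set \<Rightarrow> ('q, 'k, 'v) qmod \<Rightarrow> 'q \<Rightarrow> 'v set"
where
  "global_support K Qp \<tau> M q =
     {x \<in> carrier (qpart M q). \<forall>\<tau>'. face Qp \<tau>' \<and> \<not> \<tau>' \<subseteq> \<tau> \<longrightarrow>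
        loc_map K Qp \<tau>' M q x = \<zero>\<^bsub>qpart (localization K Qp \<tau>' M) q\<^esub>}"

definition coprimary ::
  "('k, 'r) ring_scheme \<Rightarrow> 'q::ab_group_add set \<Rightarrow> ('q, 'k, 'v) qmod \<Rightarrow> bool"
where
  "coprimary K Qp M \<longleftrightarrow>
     (\<exists>\<tau>. face Qp \<tau> \<and>
        qinjective M (loc_map K Qp \<tau> M) \<and>
        essential_qsubmodule K Qp
          (global_support K Qp \<tau> (localization K Qp \<tau> M)) (localization K Qp \<tau> M))"

text \<open>
  The injection is the canonical map whose components are the projections \<open>M \<rightarrow> M/M\<^sub>i\<close>, for
  \<open>i < r\<close>.
\<close>

definition primary_decomposition ::
  "('k, 'r) ring_scheme \<Rightarrow> 'q::ab_group_add set \<Rightarrow> ('q, 'k, 'v) qmod \<Rightarrow> nat \<Rightarrow>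
     (nat \<Rightarrow> 'q \<Rightarrow> 'v set) \<Rightarrow> bool"
where
  "primary_decomposition K Qp M r N \<longleftrightarrow>
     (\<forall>i<r. qsubmodule K Qp (N i) M \<and> coprimary K Qp (qquot M (N i))) \<and>
     (let \<phi> = (\<lambda>q x. \<lambda>i\<in>{..<r}. qproj M (N i) q x)
      in qhom K Qp M (qdsum {..<r} (\<lambda>i. qquot M (N i))) \<phi> \<and> qinjective M \<phi>)"

end

theory Submission
  imports Defs
begin

text \<open>
  A downset hull embeds \<open>M\<close> in a finite direct sum of downset modules \<open>K[D]\<close>.  Each downset \<open>D\<close> is a
  finite union of coprimary downsets \<open>P\<close>, one for each face (lemma
  \<open>downset_eq_Union_coprimary_part\<close>), so \<open>K[D]\<close> embeds in the direct sum of its quotients \<open>K[P]\<close>.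
  Composing, \<open>M\<close> embeds in a finite direct sum of modules \<open>K[P]\<close> with \<open>P\<close> coprimary.  The submodules
  \<open>M\<^sub>i\<close> are the kernels of the components of this embedding: their intersection is zero, and each
  \<open>M/M\<^sub>i\<close> is isomorphic to a submodule of some \<open>K[P]\<close>.

  It remains to see that a submodule \<open>L\<close> of \<open>K[P]\<close> is coprimary if \<open>P\<close> is coprimary for a face \<open>\<tau>\<close>
  (lemma \<open>coprimary_if_downset_embedding\<close>).  Localization along any face \<open>\<tau>'\<close> turns an embedding of \<open>L\<close>
  in \<open>K[P]\<close> into one of the localization in \<open>K[P']\<close>, where \<open>P'\<close> consists of the degrees \<open>q\<close> with
  \<open>q + \<tau>'\<close> inside \<open>P\<close> (lemma \<open>downset_embedding_localization\<close>).  For \<open>\<tau>' = \<tau>\<close> this is \<open>P\<close> itself, and the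
  localization map is injective; the other faces determine in which degrees the elements are supported
  on \<open>\<tau>\<close>, and coprimary downsets are made such that every nonzero element can be pushed up to such a degree
  without becoming zero.

  The tensor product is controlled by linear forms.  A map to a downset module is in each
  degree a linear form with values in \<open>K\<close>; the tensor relations turn out to span the kernel of such a
  form on the free module on the generators \<open>x \<otimes> y\<close> (lemma \<open>ker_eq\<close>), and a quotient by kernels of
  linear forms inherits its whole structure from \<open>K\<close>
  (lemma \<open>qmodule_quotient_by_form_kernels\<close>).
\<close>

section \<open>Coprimary downsets\<close>

text \<open>
  These are the degrees in which the localization of \<open>K[D]\<close> along \<open>\<tau>\<close> is nonzero: an element survives
  iff no monomial from \<open>\<tau>\<close> pushes it out of \<open>D\<close>.
\<close>
definition loc_downset :: "'q::ab_group_add set \<Rightarrow> 'q set \<Rightarrow> 'q set" where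
  "loc_downset \<tau> D = {q. \<forall>z\<in>\<tau>. q + z \<in> D}"

text \<open>
  Stability under \<open>\<tau>\<close> makes \<open>K[P]\<close> equal to its localization along \<open>\<tau>\<close>.  The degrees \<open>s\<close> of the last
  clause are those in which \<open>K[P]\<close> dies in the localization along every face outside \<open>\<tau>\<close>; having
  one above each degree of \<open>P\<close> is what makes the part supported on \<open>\<tau>\<close> essential.
\<close>
definition coprimary_downset :: "'q::ab_group_add set \<Rightarrow> 'q set \<Rightarrow> 'q set \<Rightarrow> bool" where
  "coprimary_downset Qp \<tau> P \<longleftrightarrow> downset Qp P \<and> loc_downset \<tau> P = P \<and>
     (\<forall>q\<in>P. \<exists>s\<in>P. po_le Qp q s \<and> (\<forall>\<tau>'. face Qp \<tau>' \<and> \<not> \<tau>' \<subseteq> \<tau> \<longrightarrow> s \<notin> loc_downset \<tau>' P))"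

text \<open>
  Call a face \<open>\<sigma>\<close> a direction at \<open>s\<close> if \<open>s + \<sigma>\<close> stays in \<open>D\<close>.  The generators \<open>s\<close> of this
  downset are the degrees at which \<open>\<tau>\<close> is the largest direction.
\<close>
definition coprimary_part :: "'q::ab_group_add set \<Rightarrow> 'q set \<Rightarrow> 'q set \<Rightarrow> 'q set" where
  "coprimary_part Qp \<tau> D =
     {q. \<exists>s \<in> loc_downset \<tau> D. po_le Qp q s \<and>
        (\<forall>\<tau>'. face Qp \<tau>' \<and> \<not> \<tau>' \<subseteq> \<tau> \<longrightarrow> s \<notin> loc_downset \<tau>' D)}"

lemma faceD:
  assumes "face Qp \<tau>"
  shows face_subset: "\<tau> \<subseteq> Qp" and face_zero: "0 \<in> \<tau>"
    and face_add: "\<lbrakk>x \<in> \<tau>; y \<in> \<tau>\<rbrakk> \<Longrightarrow> x + y \<in> \<tau>"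
  using assms by (auto simp: face_def)

lemma downsetD: "\<lbrakk>downset Qp D; po_le Qp q q'; q' \<in> D\<rbrakk> \<Longrightarrow> q \<in> D"
  by (auto simp: downset_def)

lemma loc_downset_subset: "face Qp \<tau> \<Longrightarrow> loc_downset \<tau> D \<subseteq> D"
  using face_zero by (force simp: loc_downset_def)

lemma loc_downset_mono: "D \<subseteq> D' \<Longrightarrow> loc_downset \<tau> D \<subseteq> loc_downset \<tau> D'"
  by (auto simp: loc_downset_def)

lemma loc_downset_shift: "\<lbrakk>face Qp \<tau>; q \<in> loc_downset \<tau> D; z \<in> \<tau>\<rbrakk> \<Longrightarrow> q + z \<in> loc_downset \<tau> D"
  using face_add by (force simp: loc_downset_def add.assoc)

lemma downset_loc_downset:
  assumes "downset Qp D"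
  shows "downset Qp (loc_downset \<tau> D)"
  unfolding downset_def loc_downset_def
proof clarify
  fix q q' z assume "po_le Qp q q'" "\<forall>z\<in>\<tau>. q' + z \<in> D" "z \<in> \<tau>"
  moreover have "po_le Qp (q + z) (q' + z)"
    using \<open>po_le Qp q q'\<close> by (simp add: po_le_def)
  ultimately show "q + z \<in> D"
    using assms downsetD by blast
qed

context po_group
begin

lemma po_le_refl: "po_le Qp q q"
  using zero_mem by (simp add: po_le_def)

lemma po_le_trans: "\<lbrakk>po_le Qp q q'; po_le Qp q' q''\<rbrakk> \<Longrightarrow> po_le Qp q q''"
  using add_mem[of "q' - q" "q'' - q'"] by (simp add: po_le_def)

lemma po_le_add: "z \<in> Qp \<Longrightarrow> po_le Qp q (q + z)"
  by (simp add: po_le_def)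

lemma face_zero_singleton: "face Qp {0}"
proof -
  have "x + y \<noteq> 0" if "x \<in> Qp" "y \<in> Qp" "x \<noteq> 0" for x y
    using that trivial_units[of x] by (metis add.inverse_unique)
  then show ?thesis
    using zero_mem add_mem by (auto simp: face_def)
qed

text \<open>
  The face \<open>\<rho>\<close> is the join of \<open>\<tau>\<close> and \<open>\<tau>'\<close> among the faces.  Its elements lie below sums from \<open>\<tau> + \<tau>'\<close>,
  so a downset that contains \<open>s + \<tau> + \<tau>'\<close> contains \<open>s + \<rho>\<close>.
\<close>
lemma face_join:
  assumes "face Qp \<tau>" "face Qp \<tau>'"
  defines "\<rho> \<equiv> {x \<in> Qp. \<exists>z\<in>\<tau>. \<exists>z'\<in>\<tau>'. po_le Qp x (z + z')}"
  shows "face Qp \<rho>" "\<tau> \<subseteq> \<rho>" "\<tau>' \<subseteq> \<rho>"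
proof -
  have closed: "x + y \<in> \<rho>" if xy: "x \<in> \<rho>" "y \<in> \<rho>" for x y
  proof -
    obtain z z' w w' where *: "z \<in> \<tau>" "z' \<in> \<tau>'" "z + z' - x \<in> Qp" "w \<in> \<tau>" "w' \<in> \<tau>'" "w + w' - y \<in> Qp"
      using xy by (auto simp: \<rho>_def po_le_def)
    have "(z + w) + (z' + w') - (x + y) = (z + z' - x) + (w + w' - y)"
      by (simp add: algebra_simps)
    then have "po_le Qp (x + y) ((z + w) + (z' + w'))"
      using add_mem[OF *(3,6)] by (simp only: po_le_def)
    then show ?thesis
      using * xy add_mem face_add[OF assms(1)] face_add[OF assms(2)] unfolding \<rho>_def by blast
  qed
  have ideal: "x + y \<notin> \<rho>" if "x \<in> Qp" "x \<notin> \<rho>" "y \<in> Qp" for x y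
    using that po_le_trans[OF po_le_add[of y x]] unfolding \<rho>_def by blast
  have z: "0 \<in> \<tau>" "0 \<in> \<tau>'"
    using assms face_zero by auto
  moreover have "po_le Qp 0 (0 + 0)"
    by (simp add: po_le_refl)
  ultimately have "0 \<in> \<rho>"
    using zero_mem unfolding \<rho>_def by blast
  moreover have "\<rho> \<subseteq> Qp"
    unfolding \<rho>_def by blast
  ultimately show "face Qp \<rho>"
    using closed ideal add_mem unfolding face_def by blast
  show "\<tau> \<subseteq> \<rho>"
  proof
    fix x assume "x \<in> \<tau>"
    moreover have "po_le Qp x (x + 0)"
      by (simp add: po_le_refl)
    ultimately show "x \<in> \<rho>"
      using face_subset[OF assms(1)] z(2) unfolding \<rho>_def by blast
  qed
  show "\<tau>' \<subseteq> \<rho>"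
  proof
    fix x assume "x \<in> \<tau>'"
    moreover have "po_le Qp x (0 + x)"
      by (simp add: po_le_refl)
    ultimately show "x \<in> \<rho>"
      using face_subset[OF assms(2)] z(1) unfolding \<rho>_def by blast
  qed
qed

lemma coprimary_part_subset:
  assumes "downset Qp D" "face Qp \<tau>"
  shows "coprimary_part Qp \<tau> D \<subseteq> D"
  using assms loc_downset_subset[OF assms(2)] downsetD unfolding coprimary_part_def by blast

text \<open>
  Directions can only be lost on the way up.  Hence if \<open>\<tau>\<close> is the largest direction at \<open>s\<close>, it still is at
  \<open>s + z\<close> for \<open>z \<in> \<tau>\<close>, which gives stability under \<open>\<tau>\<close>; and the generators themselves witness the last
  clause of the definition, as \<open>D\<close> contains the part.
\<close>
lemma coprimary_downset_coprimary_part: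
  assumes D: "downset Qp D" and \<tau>: "face Qp \<tau>"
  shows "coprimary_downset Qp \<tau> (coprimary_part Qp \<tau> D)"
proof -
  let ?P = "coprimary_part Qp \<tau> D"
  have "downset Qp ?P"
    unfolding downset_def coprimary_part_def using po_le_trans by blast
  moreover have "loc_downset \<tau> ?P = ?P"
  proof (rule antisym[OF loc_downset_subset[OF \<tau>]], rule subsetI)
    fix q assume "q \<in> ?P"
    then obtain s where s: "s \<in> loc_downset \<tau> D" "po_le Qp q s"
        "\<And>\<tau>'. face Qp \<tau>' \<Longrightarrow> \<not> \<tau>' \<subseteq> \<tau> \<Longrightarrow> s \<notin> loc_downset \<tau>' D"
      unfolding coprimary_part_def by blast
    have "q + z \<in> ?P" if z: "z \<in> \<tau>" for z
    proof -
      have "s + z \<in> loc_downset \<tau> D"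
        using loc_downset_shift[OF \<tau> s(1) z] .
      moreover have "po_le Qp (q + z) (s + z)"
        using s(2) by (simp add: po_le_def)
      moreover have "s + z \<notin> loc_downset \<tau>' D" if "face Qp \<tau>'" "\<not> \<tau>' \<subseteq> \<tau>" for \<tau>'
        using s(3)[OF that] downset_loc_downset[OF D] po_le_add face_subset[OF \<tau>] z
        by (meson downsetD subsetD)
      ultimately show ?thesis
        unfolding coprimary_part_def by blast
    qed
    then show "q \<in> loc_downset \<tau> ?P"
      by (simp add: loc_downset_def)
  qed
  moreover have "\<exists>s\<in>?P. po_le Qp q s \<and> (\<forall>\<tau>'. face Qp \<tau>' \<and> \<not> \<tau>' \<subseteq> \<tau> \<longrightarrow> s \<notin> loc_downset \<tau>' ?P)"
    if q: "q \<in> ?P" for q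
  proof -
    obtain s where s: "s \<in> loc_downset \<tau> D" "po_le Qp q s"
        "\<And>\<tau>'. face Qp \<tau>' \<Longrightarrow> \<not> \<tau>' \<subseteq> \<tau> \<Longrightarrow> s \<notin> loc_downset \<tau>' D"
      using q unfolding coprimary_part_def by blast
    have "s \<in> ?P"
      using s po_le_refl unfolding coprimary_part_def by blast
    moreover have "s \<notin> loc_downset \<tau>' ?P" if "face Qp \<tau>'" "\<not> \<tau>' \<subseteq> \<tau>" for \<tau>'
      using s(3)[OF that] loc_downset_mono[OF coprimary_part_subset[OF D \<tau>]] by blast
    ultimately show ?thesis
      using s(2) by blast
  qed
  ultimately show ?thesis
    unfolding coprimary_downset_def by blast
qed

end

text \<open>
  Above a given degree of \<open>D\<close> choose \<open>s \<in> D\<close> with as few directions as possible, which needs the number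
  of faces to be finite.  At every degree of \<open>D\<close> above \<open>s\<close> the directions are then the same, so if
  \<open>\<tau>\<close> and \<open>\<tau>'\<close> are directions at \<open>s\<close>, then \<open>\<tau>'\<close> is a direction at each point of \<open>s + \<tau>\<close>, and the join of
  the two is a direction at \<open>s\<close>.  A set of faces that is finite, nonempty and closed under joins has a
  largest element \<open>\<tau>\<close>, and \<open>s\<close> generates part of the coprimary part for \<open>\<tau>\<close>.
\<close>
lemma (in polyhedral_po_group) downset_eq_Union_coprimary_part:
  assumes D: "downset Qp D"
  shows "D = (\<Union>\<tau>\<in>{\<tau>. face Qp \<tau>}. coprimary_part Qp \<tau> D)"
proof (rule antisym)
  show "(\<Union>\<tau>\<in>{\<tau>. face Qp \<tau>}. coprimary_part Qp \<tau> D) \<subseteq> D"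
    using coprimary_part_subset[OF D] by blast
next
  let ?F = "\<lambda>s. {\<tau>. face Qp \<tau> \<and> s \<in> loc_downset \<tau> D}"
  have fin: "finite (?F s)" for s
    using finite_faces by (rule rev_finite_subset) blast
  have anti: "?F s' \<subseteq> ?F s" if "po_le Qp s s'" for s s'
    using downset_loc_downset[OF D] downsetD that by blast
  show "D \<subseteq> (\<Union>\<tau>\<in>{\<tau>. face Qp \<tau>}. coprimary_part Qp \<tau> D)"
  proof
    fix q assume "q \<in> D"
    then have "q \<in> D \<and> po_le Qp q q"
      using po_le_refl by blast
    then obtain s where s: "s \<in> D" "po_le Qp q s"
        and min: "\<And>s'. s' \<in> D \<Longrightarrow> po_le Qp q s' \<Longrightarrow> card (?F s) \<le> card (?F s')"
      using ex_has_least_nat[of "\<lambda>s. s \<in> D \<and> po_le Qp q s" q "\<lambda>s. card (?F s)"] by blast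
    \<comment> \<open>Going up from \<open>s\<close> within \<open>D\<close> no longer loses directions.\<close>
    have const: "?F s' = ?F s" if "s' \<in> D" "po_le Qp s s'" for s'
      using card_seteq[OF fin anti[OF that(2)]] min[of s'] that s(2) po_le_trans by blast
    have join: "\<exists>\<rho>\<in>?F s. \<tau> \<subseteq> \<rho> \<and> \<tau>' \<subseteq> \<rho>" if \<tau>: "\<tau> \<in> ?F s" and \<tau>': "\<tau>' \<in> ?F s" for \<tau> \<tau>'
    proof -
      let ?\<rho> = "{x \<in> Qp. \<exists>z\<in>\<tau>. \<exists>z'\<in>\<tau>'. po_le Qp x (z + z')}"
      have "s + x \<in> D" if "x \<in> Qp" "z \<in> \<tau>" "z' \<in> \<tau>'" "po_le Qp x (z + z')" for x z z'
      proof -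
        have "s + z \<in> D" "po_le Qp s (s + z)"
          using \<tau> that(2) face_subset[of Qp \<tau>] po_le_add by (auto simp: loc_downset_def)
        then have "s + z \<in> loc_downset \<tau>' D"
          using const[of "s + z"] \<tau>' by blast
        then have "s + z + z' \<in> D"
          using that(3) by (simp add: loc_downset_def)
        moreover have "po_le Qp (s + x) (s + z + z')"
          using that(4) by (simp add: po_le_def algebra_simps)
        ultimately show ?thesis
          using D downsetD by blast
      qed
      then have "s \<in> loc_downset ?\<rho> D"
        by (auto simp: loc_downset_def)
      moreover have "face Qp ?\<rho>" "\<tau> \<subseteq> ?\<rho>" "\<tau>' \<subseteq> ?\<rho>"
        using face_join[of \<tau> \<tau>'] \<tau> \<tau>' by auto
      ultimately show ?thesis
        by blast
    qed
    have "{0} \<in> ?F s"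
      using face_zero_singleton s(1) by (simp add: loc_downset_def)
    then obtain \<tau> where \<tau>: "\<tau> \<in> ?F s" "\<And>\<rho>. \<rho> \<in> ?F s \<Longrightarrow> \<tau> \<subseteq> \<rho> \<Longrightarrow> \<tau> = \<rho>"
      using finite_has_maximal2[OF fin, of "{0}" s] by blast
    then have "\<tau>' \<subseteq> \<tau>" if "\<tau>' \<in> ?F s" for \<tau>'
      using join[OF \<tau>(1) that] by blast
    then have "q \<in> coprimary_part Qp \<tau> D"
      using s(2) \<tau>(1) unfolding coprimary_part_def by blast
    then show "q \<in> (\<Union>\<tau>\<in>{\<tau>. face Qp \<tau>}. coprimary_part Qp \<tau> D)"
      using \<tau>(1) by blast
  qed
qed

section \<open>Quotients by kernels of linear forms\<close>

abbreviation linear_form :: "('k, 'r) ring_scheme \<Rightarrow> ('k, 'v, 'a) module_scheme \<Rightarrow> ('v \<Rightarrow> 'k) \<Rightarrow> bool" where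
  "linear_form K V f \<equiv> f \<in> vs_hom K V (vs_self K)"

definition form_kernel :: "('k, 'r) ring_scheme \<Rightarrow> ('k, 'v, 'a) module_scheme \<Rightarrow> ('v \<Rightarrow> 'k) \<Rightarrow> 'v set" where
  "form_kernel K V f = {x \<in> carrier V. f x = \<zero>\<^bsub>K\<^esub>}"

lemma linear_form_iff:
  "linear_form K V f \<longleftrightarrow> f \<in> carrier V \<rightarrow> carrier K \<and>
     (\<forall>x\<in>carrier V. \<forall>y\<in>carrier V. f (x \<oplus>\<^bsub>V\<^esub> y) = f x \<oplus>\<^bsub>K\<^esub> f y) \<and>
     (\<forall>c\<in>carrier K. \<forall>x\<in>carrier V. f (c \<odot>\<^bsub>V\<^esub> x) = c \<otimes>\<^bsub>K\<^esub> f x)"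
  by (simp add: vs_hom_def vs_self_def)

text \<open>
  The laws of a module are inherited from \<open>K\<close> along an injective map that respects the operations.
  All quotients below are handled in this way.
\<close>
lemma module_of_injective_form:
  assumes K: "cring K"
    and closed: "\<zero>\<^bsub>V\<^esub> \<in> carrier V" "\<And>x y. \<lbrakk>x \<in> carrier V; y \<in> carrier V\<rbrakk> \<Longrightarrow> x \<oplus>\<^bsub>V\<^esub> y \<in> carrier V"
      "\<And>c x. \<lbrakk>c \<in> carrier K; x \<in> carrier V\<rbrakk> \<Longrightarrow> c \<odot>\<^bsub>V\<^esub> x \<in> carrier V"
    and f: "linear_form K V f" "f \<zero>\<^bsub>V\<^esub> = \<zero>\<^bsub>K\<^esub>" "inj_on f (carrier V)"
  shows "module K V"
proof -
  interpret K: cring K by fact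
  have fc: "f x \<in> carrier K" if "x \<in> carrier V" for x
    using f(1) that by (auto simp: linear_form_iff)
  have hom_add: "f (x \<oplus>\<^bsub>V\<^esub> y) = f x \<oplus>\<^bsub>K\<^esub> f y" if "x \<in> carrier V" "y \<in> carrier V" for x y
    using f(1) that by (auto simp: linear_form_iff)
  have hom_smult: "f (c \<odot>\<^bsub>V\<^esub> x) = c \<otimes>\<^bsub>K\<^esub> f x" if "x \<in> carrier V" "c \<in> carrier K" for x c
    using f(1) that by (auto simp: linear_form_iff)
  have eqI: "x = y" if "f x = f y" "x \<in> carrier V" "y \<in> carrier V" for x y
    using f(3) that by (auto dest: inj_onD)
  show ?thesis
  proof (rule moduleI[OF K abelian_groupI])
    show "\<exists>y\<in>carrier V. y \<oplus>\<^bsub>V\<^esub> x = \<zero>\<^bsub>V\<^esub>" if x: "x \<in> carrier V" for x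
    proof
      show "(\<ominus>\<^bsub>K\<^esub> \<one>\<^bsub>K\<^esub>) \<odot>\<^bsub>V\<^esub> x \<oplus>\<^bsub>V\<^esub> x = \<zero>\<^bsub>V\<^esub>"
        using x by (intro eqI) (simp_all add: closed hom_add hom_smult f(2) fc K.l_minus K.l_neg)
    qed (use x closed in simp)
  qed (rule closed; assumption | rule eqI; simp add: closed hom_add hom_smult f(2) fc K.add.m_ac K.l_distr K.r_distr K.m_assoc)+
qed

context module
begin

lemma linear_formD:
  assumes f: "linear_form R M f"
  shows "x \<in> carrier M \<Longrightarrow> f x \<in> carrier R"
    and "\<lbrakk>x \<in> carrier M; y \<in> carrier M\<rbrakk> \<Longrightarrow> f (x \<oplus>\<^bsub>M\<^esub> y) = f x \<oplus> f y"
    and "\<lbrakk>c \<in> carrier R; x \<in> carrier M\<rbrakk> \<Longrightarrow> f (c \<odot>\<^bsub>M\<^esub> x) = c \<otimes> f x"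
    and "f \<zero>\<^bsub>M\<^esub> = \<zero>"
    and "x \<in> carrier M \<Longrightarrow> f (\<ominus>\<^bsub>M\<^esub> x) = \<ominus> f x"
    and "\<lbrakk>x \<in> carrier M; y \<in> carrier M\<rbrakk> \<Longrightarrow> f (x \<ominus>\<^bsub>M\<^esub> y) = f x \<ominus> f y"
proof -
  show c: "f x \<in> carrier R" if "x \<in> carrier M" for x
    using f that by (auto simp: linear_form_iff)
  show a: "f (x \<oplus>\<^bsub>M\<^esub> y) = f x \<oplus> f y" if "x \<in> carrier M" "y \<in> carrier M" for x y
    using f that by (auto simp: linear_form_iff)
  show s: "f (c \<odot>\<^bsub>M\<^esub> x) = c \<otimes> f x" if "c \<in> carrier R" "x \<in> carrier M" for c x
    using f that by (auto simp: linear_form_iff)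
  show "f \<zero>\<^bsub>M\<^esub> = \<zero>"
    using s[of \<zero> "\<zero>\<^bsub>M\<^esub>"] c by simp
  show m: "f (\<ominus>\<^bsub>M\<^esub> x) = \<ominus> f x" if x: "x \<in> carrier M" for x
    using s[of "\<ominus> \<one>" x] smult_l_minus[of \<one> x] x c by (simp add: R.l_minus)
  show "f (x \<ominus>\<^bsub>M\<^esub> y) = f x \<ominus> f y" if "x \<in> carrier M" "y \<in> carrier M" for x y
    using a[of x "\<ominus>\<^bsub>M\<^esub> y"] m that by (simp add: a_minus_def)
qed

lemma linear_form_finsum:
  assumes f: "linear_form R M f" and A: "finite A" "g \<in> A \<rightarrow> carrier M"
  shows "f (\<Oplus>\<^bsub>M\<^esub>i\<in>A. g i) = (\<Oplus>i\<in>A. f (g i))"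
  using A
proof (induction A)
  case (insert a A)
  then have "g \<in> A \<rightarrow> carrier M" "g a \<in> carrier M" "(\<lambda>i. f (g i)) \<in> A \<rightarrow> carrier R" "f (g a) \<in> carrier R"
    using linear_formD(1)[OF f] by auto
  then show ?case
    using insert by (simp add: linear_formD[OF f] M.finsum_closed)
qed (simp add: linear_formD[OF f])

lemma submodule_form_kernel:
  assumes f: "linear_form R M f"
  shows "submodule (form_kernel R M f) R M"
  by (rule submoduleI) (auto simp: form_kernel_def linear_formD[OF f])

lemma form_kernel_coset:
  assumes f: "linear_form R M f" and x: "x \<in> carrier M"
  shows "form_kernel R M f +>\<^bsub>M\<^esub> x = {y \<in> carrier M. f y = f x}"
proof (intro equalityI subsetI)
  fix y assume "y \<in> form_kernel R M f +>\<^bsub>M\<^esub> x"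
  then show "y \<in> {y \<in> carrier M. f y = f x}"
    using x by (auto simp: a_r_coset_def' form_kernel_def linear_formD[OF f])
next
  fix y assume "y \<in> {y \<in> carrier M. f y = f x}"
  then have "y \<ominus>\<^bsub>M\<^esub> x \<in> form_kernel R M f" and "y = (y \<ominus>\<^bsub>M\<^esub> x) \<oplus>\<^bsub>M\<^esub> x"
    using x linear_formD[OF f]
    by (auto simp: form_kernel_def M.minus_eq R.minus_eq R.r_neg M.a_assoc M.l_neg)
  then show "y \<in> form_kernel R M f +>\<^bsub>M\<^esub> x"
    by (auto simp: a_r_coset_def')
qed

end

text \<open>
  The cosets of the kernel of \<open>f\<close> are the fibres of \<open>f\<close>, so the operations on cosets can be computed on
  representatives, and \<open>f\<close> is constant on each coset.
\<close>
lemma vs_quot_form_kernel: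
  fixes V :: "('k, 'v) module"
  assumes "module K V" and f: "linear_form K V f"
  defines "N \<equiv> form_kernel K V f"
  shows "carrier (vs_quot V N) = (\<lambda>x. N +>\<^bsub>V\<^esub> x) ` carrier V"
    and "\<zero>\<^bsub>vs_quot V N\<^esub> = N +>\<^bsub>V\<^esub> \<zero>\<^bsub>V\<^esub>"
    and "\<lbrakk>x \<in> carrier V; y \<in> carrier V\<rbrakk> \<Longrightarrow>
      (N +>\<^bsub>V\<^esub> x) \<oplus>\<^bsub>vs_quot V N\<^esub> (N +>\<^bsub>V\<^esub> y) = N +>\<^bsub>V\<^esub> (x \<oplus>\<^bsub>V\<^esub> y)"
    and "\<lbrakk>c \<in> carrier K; x \<in> carrier V\<rbrakk> \<Longrightarrow>
      c \<odot>\<^bsub>vs_quot V N\<^esub> (N +>\<^bsub>V\<^esub> x) = N +>\<^bsub>V\<^esub> (c \<odot>\<^bsub>V\<^esub> x)"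
    and "x \<in> carrier V \<Longrightarrow> the_elem (f ` (N +>\<^bsub>V\<^esub> x)) = f x"
proof -
  interpret module K V by fact
  note fD = linear_formD[OF f]
  have coset: "N +>\<^bsub>V\<^esub> x = {y \<in> carrier V. f y = f x}" if "x \<in> carrier V" for x
    unfolding N_def by (rule form_kernel_coset[OF f that])
  show "carrier (vs_quot V N) = (\<lambda>x. N +>\<^bsub>V\<^esub> x) ` carrier V"
    by (auto simp: vs_quot_def A_RCOSETS_def')
  show "\<zero>\<^bsub>vs_quot V N\<^esub> = N +>\<^bsub>V\<^esub> \<zero>\<^bsub>V\<^esub>"
    unfolding coset[OF M.zero_closed] by (simp add: vs_quot_def N_def form_kernel_def fD)
  show "(N +>\<^bsub>V\<^esub> x) \<oplus>\<^bsub>vs_quot V N\<^esub> (N +>\<^bsub>V\<^esub> y) = N +>\<^bsub>V\<^esub> (x \<oplus>\<^bsub>V\<^esub> y)"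
    if xy: "x \<in> carrier V" "y \<in> carrier V" for x y
  proof -
    have "\<exists>x'. x' \<in> carrier V \<and> f x' = f x \<and> (\<exists>y'. y' \<in> carrier V \<and> f y' = f y \<and> z = x' \<oplus>\<^bsub>V\<^esub> y')"
      if z: "z \<in> carrier V" "f z = f x \<oplus>\<^bsub>K\<^esub> f y" for z
    proof (rule exI[of _ x], intro conjI exI[of _ "z \<ominus>\<^bsub>V\<^esub> x"])
      show "f (z \<ominus>\<^bsub>V\<^esub> x) = f y"
        using z xy fD(1)[of x] fD(1)[of y] R.add.m_lcomm[of "f x" "f y" "\<ominus>\<^bsub>K\<^esub> f x"]
        by (simp add: fD R.minus_eq R.a_assoc R.r_neg)
      show "z = x \<oplus>\<^bsub>V\<^esub> (z \<ominus>\<^bsub>V\<^esub> x)"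
        using z xy M.add.m_lcomm[of x z "\<ominus>\<^bsub>V\<^esub> x"] by (simp add: M.minus_eq M.r_neg)
    qed (use xy z in auto)
    then show ?thesis
      using xy by (auto simp: coset vs_quot_def set_add_def' fD)
  qed
  show "c \<odot>\<^bsub>vs_quot V N\<^esub> (N +>\<^bsub>V\<^esub> x) = N +>\<^bsub>V\<^esub> (c \<odot>\<^bsub>V\<^esub> x)"
    if "c \<in> carrier K" "x \<in> carrier V" for c x
  proof -
    have "N +>\<^bsub>V\<^esub> (c \<odot>\<^bsub>V\<^esub> y) = N +>\<^bsub>V\<^esub> (c \<odot>\<^bsub>V\<^esub> x)" if "y \<in> N +>\<^bsub>V\<^esub> x" for y
      using that \<open>c \<in> carrier K\<close> \<open>x \<in> carrier V\<close> by (auto simp: coset fD)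
    then have "c \<odot>\<^bsub>vs_quot V N\<^esub> (N +>\<^bsub>V\<^esub> x) = (\<Union>y \<in> N +>\<^bsub>V\<^esub> x. N +>\<^bsub>V\<^esub> (c \<odot>\<^bsub>V\<^esub> x))"
      by (simp add: vs_quot_def)
    moreover have "x \<in> N +>\<^bsub>V\<^esub> x"
      using that by (simp add: coset)
    ultimately show ?thesis
      by blast
  qed
  show "the_elem (f ` (N +>\<^bsub>V\<^esub> x)) = f x" if "x \<in> carrier V" for x
  proof -
    have "f ` (N +>\<^bsub>V\<^esub> x) = {f x}"
      using that by (auto simp: coset)
    then show ?thesis by simp
  qed
qed

lemma module_vs_quot_form_kernel:
  fixes V :: "('k, 'v) module"
  assumes "module K V" and f: "linear_form K V f"
  defines "N \<equiv> form_kernel K V f"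
  shows "module K (vs_quot V N)"
    and "linear_form K (vs_quot V N) (\<lambda>X. the_elem (f ` X))"
    and "inj_on (\<lambda>X. the_elem (f ` X)) (carrier (vs_quot V N))"
proof -
  interpret module K V by fact
  note q = vs_quot_form_kernel[OF \<open>module K V\<close> f, folded N_def] and fD = linear_formD[OF f]
  show lin: "linear_form K (vs_quot V N) (\<lambda>X. the_elem (f ` X))"
    by (auto simp: linear_form_iff q fD)
  show inj: "inj_on (\<lambda>X. the_elem (f ` X)) (carrier (vs_quot V N))"
  proof (rule inj_onI)
    fix X Y assume XY: "X \<in> carrier (vs_quot V N)" "Y \<in> carrier (vs_quot V N)"
      and eq: "the_elem (f ` X) = the_elem (f ` Y)"
    obtain x y where xy: "x \<in> carrier V" "y \<in> carrier V" "X = N +>\<^bsub>V\<^esub> x" "Y = N +>\<^bsub>V\<^esub> y"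
      using XY by (auto simp: q(1))
    then have "f x = f y"
      using eq by (simp add: q(5))
    then show "X = Y"
      using xy by (simp add: N_def form_kernel_coset[OF f])
  qed
  show "module K (vs_quot V N)"
    by (rule module_of_injective_form[OF module.axioms(1)[OF \<open>module K V\<close>] _ _ _ lin _ inj]) (auto simp: q fD)
qed


section \<open>Modules embedded in a downset module\<close>

text \<open>
  Over a field such a module has components of dimension at most one, and equality of its elements is
  tested in \<open>K\<close>.  Both the quotients in the primary decomposition and their localizations are of this kind.
\<close>
definition downset_embedding ::
  "('k, 'r) ring_scheme \<Rightarrow> 'q::ab_group_add set \<Rightarrow> ('q, 'k, 'v) qmod \<Rightarrow> 'q set \<Rightarrow> ('q \<Rightarrow> 'v \<Rightarrow> 'k) \<Rightarrow> bool"
where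
  "downset_embedding K Qp L P \<phi> \<longleftrightarrow>
     qmodule K Qp L \<and> downset Qp P \<and> qhom K Qp L (indicator_qmod K P) \<phi> \<and> qinjective L \<phi>"

text \<open>
  In a downset module a structure morphism from \<open>q\<close> to \<open>q'\<close> is the identity as soon as \<open>q' \<in> P\<close>, since
  then \<open>q \<in> P\<close>.
\<close>
lemma qhom_downset_iff:
  assumes P: "downset Qp P" and K: "cring K"
  shows "qhom K Qp L (indicator_qmod K P) \<phi> \<longleftrightarrow>
     (\<forall>q. linear_form K (qpart L q) (\<phi> q)) \<and>
     (\<forall>q x. q \<notin> P \<longrightarrow> x \<in> carrier (qpart L q) \<longrightarrow> \<phi> q x = \<zero>\<^bsub>K\<^esub>) \<and>
     (\<forall>q q' x. po_le Qp q q' \<longrightarrow> x \<in> carrier (qpart L q) \<longrightarrow>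
        \<phi> q' (qmor L q q' x) = (if q' \<in> P then \<phi> q x else \<zero>\<^bsub>K\<^esub>))"
    (is "?L \<longleftrightarrow> ?A \<and> ?B \<and> ?C")
proof -
  interpret K: cring K by fact
  have hom: "\<phi> q \<in> vs_hom K (qpart L q) (qpart (indicator_qmod K P) q) \<longleftrightarrow>
      linear_form K (qpart L q) (\<phi> q) \<and> (q \<notin> P \<longrightarrow> (\<forall>x\<in>carrier (qpart L q). \<phi> q x = \<zero>\<^bsub>K\<^esub>))" for q
    by (auto simp: vs_hom_def indicator_qmod_def vs_zero_def vs_self_def Pi_iff)
  have nat: "qmor (indicator_qmod K P) q q' y = (if q' \<in> P then y else \<zero>\<^bsub>K\<^esub>)" if "po_le Qp q q'" for q q' y
    using downsetD[OF P that] by (auto simp: indicator_qmod_def)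
  show ?thesis
    unfolding qhom_def hom by (auto simp: nat)
qed

lemma downset_embeddingD:
  assumes emb: "downset_embedding K Qp L P \<phi>" and K: "cring K"
  shows "downset Qp P"
    and "module K (qpart L q)"
    and "\<lbrakk>po_le Qp q q'; x \<in> carrier (qpart L q)\<rbrakk> \<Longrightarrow> qmor L q q' x \<in> carrier (qpart L q')"
    and "linear_form K (qpart L q) (\<phi> q)"
    and "\<lbrakk>q \<notin> P; x \<in> carrier (qpart L q)\<rbrakk> \<Longrightarrow> \<phi> q x = \<zero>\<^bsub>K\<^esub>"
    and "\<lbrakk>po_le Qp q q'; x \<in> carrier (qpart L q)\<rbrakk> \<Longrightarrow>
      \<phi> q' (qmor L q q' x) = (if q' \<in> P then \<phi> q x else \<zero>\<^bsub>K\<^esub>)"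
    and "x \<in> carrier (qpart L q) \<Longrightarrow> \<phi> q x = \<zero>\<^bsub>K\<^esub> \<longleftrightarrow> x = \<zero>\<^bsub>qpart L q\<^esub>"
proof -
  show P: "downset Qp P" and mod: "module K (qpart L q)" for q
    using emb by (simp_all add: downset_embedding_def qmodule_def)
  show "qmor L q q' x \<in> carrier (qpart L q')" if "po_le Qp q q'" "x \<in> carrier (qpart L q)" for q q' x
  proof -
    have "qmor L q q' \<in> vs_hom K (qpart L q) (qpart L q')"
      using emb that(1) by (simp add: downset_embedding_def qmodule_def)
    then show ?thesis
      using that(2) by (auto simp: vs_hom_def)
  qed
  have hom: "qhom K Qp L (indicator_qmod K P) \<phi>"
    using emb by (simp add: downset_embedding_def)
  show lin: "linear_form K (qpart L q) (\<phi> q)"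
    and "\<lbrakk>q \<notin> P; x \<in> carrier (qpart L q)\<rbrakk> \<Longrightarrow> \<phi> q x = \<zero>\<^bsub>K\<^esub>"
    and "\<lbrakk>po_le Qp q q'; x \<in> carrier (qpart L q)\<rbrakk> \<Longrightarrow>
      \<phi> q' (qmor L q q' x) = (if q' \<in> P then \<phi> q x else \<zero>\<^bsub>K\<^esub>)" for q q' x
    using hom unfolding qhom_downset_iff[OF P K] by blast+
  show "\<phi> q x = \<zero>\<^bsub>K\<^esub> \<longleftrightarrow> x = \<zero>\<^bsub>qpart L q\<^esub>" if x: "x \<in> carrier (qpart L q)" for q x
  proof -
    interpret Lq: module K "qpart L q" by (rule mod)
    have "inj_on (\<phi> q) (carrier (qpart L q))"
      using emb by (simp add: downset_embedding_def qinjective_def)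
    then show ?thesis
      using x Lq.linear_formD(4)[OF lin] Lq.M.zero_closed by (metis inj_onD)
  qed
qed

text \<open>
  This is the common form of a quotient \<open>M/N\<close> and of a tensor product presented by generators and
  relations.  On the quotient the forms \<open>f\<close> separate elements, so linearity and functoriality of the
  maps induced by \<open>T\<close> follow from the formula for the values of the forms.
\<close>
lemma qmodule_quotient_by_form_kernels:
  fixes V :: "'q::ab_group_add \<Rightarrow> ('k, 'v) module" and T :: "'q \<Rightarrow> 'q \<Rightarrow> 'v \<Rightarrow> 'v"
  assumes K: "cring K" and P: "downset Qp P"
    and V: "\<And>q. module K (V q)" and f: "\<And>q. linear_form K (V q) (f q)"
    and out: "\<And>q x. \<lbrakk>q \<notin> P; x \<in> carrier (V q)\<rbrakk> \<Longrightarrow> f q x = \<zero>\<^bsub>K\<^esub>"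
    and T: "\<And>q q' x. \<lbrakk>po_le Qp q q'; x \<in> carrier (V q)\<rbrakk> \<Longrightarrow> T q q' x \<in> carrier (V q')"
    and fT: "\<And>q q' x. \<lbrakk>po_le Qp q q'; x \<in> carrier (V q)\<rbrakk> \<Longrightarrow>
      f q' (T q q' x) = (if q' \<in> P then f q x else \<zero>\<^bsub>K\<^esub>)"
    and le_refl: "\<And>q. po_le Qp q q"
    and le_trans: "\<And>q q' q''. \<lbrakk>po_le Qp q q'; po_le Qp q' q''\<rbrakk> \<Longrightarrow> po_le Qp q q''"
    and N: "\<And>q. N q = form_kernel K (V q) (f q)"
  defines "L \<equiv> \<lparr>qpart = (\<lambda>q. vs_quot (V q) (N q)),
      qmor = (\<lambda>q q' X. \<Union>x\<in>X. N q' +>\<^bsub>V q'\<^esub> T q q' x)\<rparr>"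
  shows "downset_embedding K Qp L P (\<lambda>q X. the_elem (f q ` X))"
    and "x \<in> carrier (V q) \<Longrightarrow> the_elem (f q ` (N q +>\<^bsub>V q\<^esub> x)) = f q x"
    and "\<lbrakk>po_le Qp q q'; x \<in> carrier (V q)\<rbrakk> \<Longrightarrow> qmor L q q' (N q +>\<^bsub>V q\<^esub> x) = N q' +>\<^bsub>V q'\<^esub> T q q' x"
proof -
  note q = vs_quot_form_kernel[OF V f, folded N] and m = module_vs_quot_form_kernel[OF V f, folded N]
  let ?F = "\<lambda>q X. the_elem (f q ` X)"
  have coset: "N q +>\<^bsub>V q\<^esub> x = {y \<in> carrier (V q). f q y = f q x}" if "x \<in> carrier (V q)" for q x
    unfolding N by (rule module.form_kernel_coset[OF V f that])
  have part: "qpart L q = vs_quot (V q) (N q)" for q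
    by (simp add: L_def)
  show mor: "qmor L q q' (N q +>\<^bsub>V q\<^esub> x) = N q' +>\<^bsub>V q'\<^esub> T q q' x"
    if le: "po_le Qp q q'" and x: "x \<in> carrier (V q)" for q q' x
  proof -
    have "N q' +>\<^bsub>V q'\<^esub> T q q' y = N q' +>\<^bsub>V q'\<^esub> T q q' x" if "y \<in> N q +>\<^bsub>V q\<^esub> x" for y
      using that le x by (auto simp: coset T fT)
    then have "qmor L q q' (N q +>\<^bsub>V q\<^esub> x) = (\<Union>y \<in> N q +>\<^bsub>V q\<^esub> x. N q' +>\<^bsub>V q'\<^esub> T q q' x)"
      by (simp add: L_def)
    moreover have "x \<in> N q +>\<^bsub>V q\<^esub> x"
      using x by (simp add: coset)
    ultimately show ?thesis
      by blast
  qed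
  show el: "?F q (N q +>\<^bsub>V q\<^esub> x) = f q x" if "x \<in> carrier (V q)" for q x
    using q(5) that .
  have morc: "qmor L q q' X \<in> carrier (qpart L q')"
    and Fmor: "?F q' (qmor L q q' X) = (if q' \<in> P then ?F q X else \<zero>\<^bsub>K\<^esub>)"
    if "po_le Qp q q'" "X \<in> carrier (qpart L q)" for q q' X
    using that by (auto simp: part q mor T fT el)
  have eqI: "X = Y" if "?F q X = ?F q Y" "X \<in> carrier (qpart L q)" "Y \<in> carrier (qpart L q)" for q X Y
    using inj_onD[OF m(3)] that unfolding part by blast
  note mod = m(1)[folded part]
  note lin = m(2)[folded part]
  have hom: "qhom K Qp L (indicator_qmod K P) ?F"
    unfolding qhom_downset_iff[OF P K] using lin Fmor
    by (auto simp: part q out)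
  have inj: "qinjective L ?F"
    using m(3) unfolding qinjective_def part by blast
  have "qmodule K Qp L"
    unfolding qmodule_def
  proof (intro conjI allI impI ballI)
    fix q q' assume le: "po_le Qp q q'"
    interpret Lq: module K "qpart L q" by (rule mod)
    interpret Lq': module K "qpart L q'" by (rule mod)
    interpret K: cring K by fact
    note fD = Lq.linear_formD[OF lin] Lq'.linear_formD[OF lin]
    show "qmor L q q' \<in> vs_hom K (qpart L q) (qpart L q')"
      unfolding vs_hom_def
    proof (intro CollectI conjI ballI)
      fix X Y assume "X \<in> carrier (qpart L q)" "Y \<in> carrier (qpart L q)"
      then show "qmor L q q' (X \<oplus>\<^bsub>qpart L q\<^esub> Y) = qmor L q q' X \<oplus>\<^bsub>qpart L q'\<^esub> qmor L q q' Y"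
        by (intro eqI[of q']) (auto simp: fD Fmor[OF le] morc[OF le])
    next
      fix c X assume "c \<in> carrier K" "X \<in> carrier (qpart L q)"
      then show "qmor L q q' (c \<odot>\<^bsub>qpart L q\<^esub> X) = c \<odot>\<^bsub>qpart L q'\<^esub> qmor L q q' X"
        by (intro eqI[of q']) (auto simp: fD Fmor[OF le] morc[OF le])
    qed (use morc[OF le] in blast)
  next
    fix q X assume X: "X \<in> carrier (qpart L q)"
    have "?F q X = \<zero>\<^bsub>K\<^esub>" if "q \<notin> P"
      using hom that X unfolding qhom_downset_iff[OF P K] by blast
    then show "qmor L q q X = X"
      using X le_refl by (intro eqI) (auto simp: Fmor morc)
  next
    fix q q' q'' X assume le: "po_le Qp q q'" "po_le Qp q' q''" and X: "X \<in> carrier (qpart L q)"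
    show "qmor L q' q'' (qmor L q q' X) = qmor L q q'' X"
      using X le le_trans[OF le] downsetD[OF P le(2)] by (intro eqI[of q'']) (auto simp: Fmor morc)
  qed (rule mod)
  then show "downset_embedding K Qp L P ?F"
    using P hom inj by (simp add: downset_embedding_def)
qed

section \<open>Free modules\<close>

lemma module_vs_self: "cring K \<Longrightarrow> module K (vs_self K)"
proof -
  assume "cring K"
  interpret cring K by fact
  show ?thesis
    by (rule moduleI[OF \<open>cring K\<close> abelian_groupI])
       (auto simp: vs_self_def add.m_ac l_distr r_distr m_assoc intro: l_neg)
qed

lemma module_vs_dsum:
  assumes K: "cring K" and V: "\<And>j. j \<in> J \<Longrightarrow> module K (V j)"
  shows "module K (vs_dsum J V)"
proof -
  let ?S = "vs_dsum J V"
  have sub: "finite {j \<in> J. h j \<noteq> \<zero>\<^bsub>V j\<^esub>}"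
    if "finite {j \<in> J. f j \<noteq> \<zero>\<^bsub>V j\<^esub>}" "finite {j \<in> J. g j \<noteq> \<zero>\<^bsub>V j\<^esub>}"
      "\<And>j. \<lbrakk>j \<in> J; f j = \<zero>\<^bsub>V j\<^esub>; g j = \<zero>\<^bsub>V j\<^esub>\<rbrakk> \<Longrightarrow> h j = \<zero>\<^bsub>V j\<^esub>" for f g h
    by (rule finite_subset[OF _ finite_UnI[OF that(1,2)]]) (use that(3) in auto)
  have memb: "f \<in> carrier ?S \<longleftrightarrow>
      f \<in> (\<Pi>\<^sub>E j\<in>J. carrier (V j)) \<and> finite {j \<in> J. f j \<noteq> \<zero>\<^bsub>V j\<^esub>}" for f
    by (simp add: vs_dsum_def)
  have ops: "f \<oplus>\<^bsub>?S\<^esub> g = (\<lambda>j\<in>J. f j \<oplus>\<^bsub>V j\<^esub> g j)" "c \<odot>\<^bsub>?S\<^esub> f = (\<lambda>j\<in>J. c \<odot>\<^bsub>V j\<^esub> f j)"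
      "\<zero>\<^bsub>?S\<^esub> = (\<lambda>j\<in>J. \<zero>\<^bsub>V j\<^esub>)" for f g c
    by (simp_all add: vs_dsum_def)
  have ag: "abelian_group (V j)" if "j \<in> J" for j
    using module.axioms(2)[OF V[OF that]] .
  have am: "abelian_monoid (V j)" if "j \<in> J" for j
    using abelian_group.axioms(1)[OF ag[OF that]] .
  have mem: "f j \<in> carrier (V j)" if "f \<in> carrier ?S" "j \<in> J" for f j
    using that by (auto simp: memb)
  have eqI: "f = g" if "\<And>j. j \<in> J \<Longrightarrow> f j = g j" "f \<in> carrier ?S" "g \<in> carrier ?S" for f g
    using that by (intro PiE_ext[of f J "\<lambda>j. carrier (V j)"]) (auto simp: memb)
  have z: "\<zero>\<^bsub>?S\<^esub> \<in> carrier ?S"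
    unfolding memb ops using abelian_monoid.zero_closed[OF am] by auto
  have add: "f \<oplus>\<^bsub>?S\<^esub> g \<in> carrier ?S" if "f \<in> carrier ?S" "g \<in> carrier ?S" for f g
    unfolding memb ops
  proof (rule conjI[OF _ sub[of f g]])
    show "(\<lambda>j\<in>J. f j \<oplus>\<^bsub>V j\<^esub> g j) \<in> (\<Pi>\<^sub>E j\<in>J. carrier (V j))"
      using mem that abelian_monoid.a_closed[OF am] by auto
    show "finite {j \<in> J. f j \<noteq> \<zero>\<^bsub>V j\<^esub>}" "finite {j \<in> J. g j \<noteq> \<zero>\<^bsub>V j\<^esub>}"
      using that by (simp_all add: memb)
    show "(\<lambda>j\<in>J. f j \<oplus>\<^bsub>V j\<^esub> g j) j = \<zero>\<^bsub>V j\<^esub>" if "j \<in> J" "f j = \<zero>\<^bsub>V j\<^esub>" "g j = \<zero>\<^bsub>V j\<^esub>" for j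
      using that abelian_monoid.l_zero[OF am] abelian_monoid.zero_closed[OF am] by simp
  qed
  have smult: "c \<odot>\<^bsub>?S\<^esub> f \<in> carrier ?S" if "c \<in> carrier K" "f \<in> carrier ?S" for f c
    unfolding memb ops
  proof (rule conjI[OF _ sub[of f f]])
    show "(\<lambda>j\<in>J. c \<odot>\<^bsub>V j\<^esub> f j) \<in> (\<Pi>\<^sub>E j\<in>J. carrier (V j))"
      using mem that module.smult_closed[OF V] by auto
    show "finite {j \<in> J. f j \<noteq> \<zero>\<^bsub>V j\<^esub>}" "finite {j \<in> J. f j \<noteq> \<zero>\<^bsub>V j\<^esub>}"
      using that by (simp_all add: memb)
    show "(\<lambda>j\<in>J. c \<odot>\<^bsub>V j\<^esub> f j) j = \<zero>\<^bsub>V j\<^esub>" if "j \<in> J" "f j = \<zero>\<^bsub>V j\<^esub>" for j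
      using that \<open>c \<in> carrier K\<close> module.smult_r_null[OF V] by simp
  qed
  have neg: "\<exists>g\<in>carrier ?S. g \<oplus>\<^bsub>?S\<^esub> f = \<zero>\<^bsub>?S\<^esub>" if f: "f \<in> carrier ?S" for f
  proof
    let ?g = "(\<ominus>\<^bsub>K\<^esub> \<one>\<^bsub>K\<^esub>) \<odot>\<^bsub>?S\<^esub> f"
    have m1: "\<ominus>\<^bsub>K\<^esub> \<one>\<^bsub>K\<^esub> \<in> carrier K"
      using cring.cring_simprules(3,6)[OF K] by blast
    show g: "?g \<in> carrier ?S"
      by (rule smult[OF m1 f])
    show "?g \<oplus>\<^bsub>?S\<^esub> f = \<zero>\<^bsub>?S\<^esub>"
    proof (rule eqI[OF _ add[OF g f] z])
      fix j assume j: "j \<in> J"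
      interpret module K "V j" using V[OF j] .
      show "(?g \<oplus>\<^bsub>?S\<^esub> f) j = \<zero>\<^bsub>?S\<^esub> j"
        using j mem[OF f j] by (simp add: ops smult_l_minus M.l_neg)
    qed
  qed
  have val: "(f \<oplus>\<^bsub>?S\<^esub> g) j = f j \<oplus>\<^bsub>V j\<^esub> g j" "(c \<odot>\<^bsub>?S\<^esub> f) j = c \<odot>\<^bsub>V j\<^esub> f j"
      "\<zero>\<^bsub>?S\<^esub> j = \<zero>\<^bsub>V j\<^esub>" if "j \<in> J" for f g c j
    using that by (simp_all add: ops)
  show ?thesis
  proof (rule moduleI[OF K abelian_groupI])
    fix f g h assume *: "f \<in> carrier ?S" "g \<in> carrier ?S" "h \<in> carrier ?S"
    show "(f \<oplus>\<^bsub>?S\<^esub> g) \<oplus>\<^bsub>?S\<^esub> h = f \<oplus>\<^bsub>?S\<^esub> (g \<oplus>\<^bsub>?S\<^esub> h)"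
      by (rule eqI) (use * add mem abelian_monoid.a_assoc[OF am] in \<open>auto simp: val\<close>)
  next
    fix f g assume *: "f \<in> carrier ?S" "g \<in> carrier ?S"
    show "f \<oplus>\<^bsub>?S\<^esub> g = g \<oplus>\<^bsub>?S\<^esub> f"
      by (rule eqI) (use * add mem abelian_monoid.a_comm[OF am] in \<open>auto simp: val\<close>)
  next
    fix f assume *: "f \<in> carrier ?S"
    show "\<zero>\<^bsub>?S\<^esub> \<oplus>\<^bsub>?S\<^esub> f = f"
      by (rule eqI) (use * add z mem abelian_monoid.l_zero[OF am] in \<open>auto simp: val\<close>)
    show "\<one>\<^bsub>K\<^esub> \<odot>\<^bsub>?S\<^esub> f = f"
      by (rule eqI) (use * cring.cring_simprules(6)[OF K] smult mem module.smult_one[OF V] in \<open>auto simp: val\<close>)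
  next
    fix c d f assume *: "c \<in> carrier K" "d \<in> carrier K" "f \<in> carrier ?S"
    then have cd: "c \<oplus>\<^bsub>K\<^esub> d \<in> carrier K" "c \<otimes>\<^bsub>K\<^esub> d \<in> carrier K"
      using cring.cring_simprules(1,5)[OF K] by auto
    show "(c \<oplus>\<^bsub>K\<^esub> d) \<odot>\<^bsub>?S\<^esub> f = c \<odot>\<^bsub>?S\<^esub> f \<oplus>\<^bsub>?S\<^esub> d \<odot>\<^bsub>?S\<^esub> f"
      by (rule eqI) (use * cd add smult mem module.smult_l_distr[OF V] in \<open>auto simp: val\<close>)
    show "(c \<otimes>\<^bsub>K\<^esub> d) \<odot>\<^bsub>?S\<^esub> f = c \<odot>\<^bsub>?S\<^esub> (d \<odot>\<^bsub>?S\<^esub> f)"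
      by (rule eqI) (use * cd smult mem module.smult_assoc1[OF V] in \<open>auto simp: val\<close>)
  next
    fix c f g assume *: "c \<in> carrier K" "f \<in> carrier ?S" "g \<in> carrier ?S"
    show "c \<odot>\<^bsub>?S\<^esub> (f \<oplus>\<^bsub>?S\<^esub> g) = c \<odot>\<^bsub>?S\<^esub> f \<oplus>\<^bsub>?S\<^esub> c \<odot>\<^bsub>?S\<^esub> g"
      by (rule eqI) (use * add smult mem module.smult_r_distr[OF V] in \<open>auto simp: val\<close>)
  qed (use z add smult neg in auto)
qed

definition free_basis :: "('k, 'r) ring_scheme \<Rightarrow> 'j set \<Rightarrow> 'j \<Rightarrow> 'j \<Rightarrow> 'k" where
  "free_basis K J g = (\<lambda>h\<in>J. if h = g then \<one>\<^bsub>K\<^esub> else \<zero>\<^bsub>K\<^esub>)"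

text \<open>
  The linear extension of a function \<open>l\<close> on the basis.
\<close>
definition free_extension :: "('k, 'r) ring_scheme \<Rightarrow> 'j set \<Rightarrow> ('j \<Rightarrow> 'k) \<Rightarrow> ('j \<Rightarrow> 'k) \<Rightarrow> 'k" where
  "free_extension K J l v = (\<Oplus>\<^bsub>K\<^esub> g \<in> {g \<in> J. v g \<noteq> \<zero>\<^bsub>K\<^esub>}. v g \<otimes>\<^bsub>K\<^esub> l g)"

abbreviation free_module :: "('k, 'r) ring_scheme \<Rightarrow> 'j set \<Rightarrow> ('k, 'j \<Rightarrow> 'k) module" where
  "free_module K J \<equiv> vs_dsum J (\<lambda>_. vs_self K)"

context cring
begin

lemma free_module_carrier:
  "v \<in> carrier (free_module R J) \<longleftrightarrow> v \<in> (\<Pi>\<^sub>E j\<in>J. carrier R) \<and> finite {j \<in> J. v j \<noteq> \<zero>}"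
  by (simp add: vs_dsum_def vs_self_def)

lemma module_free_module: "module R (free_module R J)"
  by (rule module_vs_dsum[OF cring_axioms module_vs_self[OF cring_axioms]])

lemma free_basis_closed: "free_basis R J g \<in> carrier (free_module R J)"
proof -
  have "finite {j \<in> J. free_basis R J g j \<noteq> \<zero>}"
    by (rule finite_subset[of _ "{g}"]) (auto simp: free_basis_def)
  then show ?thesis
    unfolding free_module_carrier by (auto simp: free_basis_def)
qed

lemma free_extension_eq:
  assumes l: "l \<in> J \<rightarrow> carrier R" and v: "v \<in> carrier (free_module R J)"
    and A: "finite A" "{g \<in> J. v g \<noteq> \<zero>} \<subseteq> A" "A \<subseteq> J"
  shows "free_extension R J l v = (\<Oplus> g \<in> A. v g \<otimes> l g)"
  unfolding free_extension_def
  using assms by (intro add.finprod_mono_neutral_cong_left) (auto simp: free_module_carrier PiE_iff Pi_iff subset_iff)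

lemma linear_form_free_extension:
  assumes l: "l \<in> J \<rightarrow> carrier R"
  shows "linear_form R (free_module R J) (free_extension R J l)"
proof -
  let ?F = "free_module R J"
  interpret F: module R ?F by (rule module_free_module)
  have supp: "finite {g \<in> J. v g \<noteq> \<zero>}" and vl: "(\<lambda>g. v g \<otimes> l g) \<in> J \<rightarrow> carrier R"
    and vc: "v \<in> J \<rightarrow> carrier R"
    if "v \<in> carrier ?F" for v
    using that l by (auto simp: free_module_carrier)
  have "free_extension R J l v \<in> carrier R" if "v \<in> carrier ?F" for v
    unfolding free_extension_def using vl[OF that] by (intro finsum_closed) auto
  moreover have "free_extension R J l (v \<oplus>\<^bsub>?F\<^esub> w) = free_extension R J l v \<oplus> free_extension R J l w"
    if v: "v \<in> carrier ?F" and w: "w \<in> carrier ?F" for v w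
  proof -
    let ?A = "{g \<in> J. v g \<noteq> \<zero>} \<union> {g \<in> J. w g \<noteq> \<zero>}"
    have val: "(v \<oplus>\<^bsub>?F\<^esub> w) g = v g \<oplus> w g" if "g \<in> J" for g
      using that by (simp add: vs_dsum_def vs_self_def)
    have A: "finite ?A" "?A \<subseteq> J"
      using supp v w by auto
    have "free_extension R J l (v \<oplus>\<^bsub>?F\<^esub> w) = (\<Oplus> g \<in> ?A. (v \<oplus>\<^bsub>?F\<^esub> w) g \<otimes> l g)"
      using v w by (intro free_extension_eq[OF l _ A(1) _ A(2)]) (auto simp: val)
    also have "\<dots> = (\<Oplus> g \<in> ?A. v g \<otimes> l g \<oplus> w g \<otimes> l g)"
      using l vc[OF v] vc[OF w] by (intro finsum_cong') (auto simp: val l_distr Pi_iff)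
    also have "\<dots> = (\<Oplus> g \<in> ?A. v g \<otimes> l g) \<oplus> (\<Oplus> g \<in> ?A. w g \<otimes> l g)"
      using vl[OF v] vl[OF w] by (intro finsum_addf) auto
    also have "\<dots> = free_extension R J l v \<oplus> free_extension R J l w"
      using free_extension_eq[OF l v A(1) _ A(2)] free_extension_eq[OF l w A(1) _ A(2)] by simp
    finally show ?thesis .
  qed
  moreover have "free_extension R J l (c \<odot>\<^bsub>?F\<^esub> v) = c \<otimes> free_extension R J l v"
    if c: "c \<in> carrier R" and v: "v \<in> carrier ?F" for c v
  proof -
    let ?A = "{g \<in> J. v g \<noteq> \<zero>}"
    have val: "(c \<odot>\<^bsub>?F\<^esub> v) g = c \<otimes> v g" if "g \<in> J" for g
      using that by (simp add: vs_dsum_def vs_self_def)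
    have "free_extension R J l (c \<odot>\<^bsub>?F\<^esub> v) = (\<Oplus> g \<in> ?A. (c \<odot>\<^bsub>?F\<^esub> v) g \<otimes> l g)"
      using c v supp[OF v] by (intro free_extension_eq[OF l]) (auto simp: val)
    also have "\<dots> = (\<Oplus> g \<in> ?A. c \<otimes> (v g \<otimes> l g))"
      using c l vc[OF v] by (intro finsum_cong') (auto simp: val m_assoc Pi_iff)
    also have "\<dots> = c \<otimes> free_extension R J l v"
      unfolding free_extension_def
      using c vl[OF v] supp[OF v] by (intro finsum_rdistr[symmetric]) auto
    finally show ?thesis .
  qed
  ultimately show ?thesis
    by (auto simp: linear_form_iff)
qed

lemma free_extension_basis:
  assumes l: "l \<in> J \<rightarrow> carrier R" and g: "g \<in> J"
  shows "free_extension R J l (free_basis R J g) = l g"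
proof -
  have "free_extension R J l (free_basis R J g) = (\<Oplus> h \<in> {g}. free_basis R J g h \<otimes> l h)"
    using g by (intro free_extension_eq[OF l free_basis_closed]) (auto simp: free_basis_def)
  also have "\<dots> = l g"
    using l g by (subst finsum_insert) (auto simp: free_basis_def Pi_iff)
  finally show ?thesis .
qed

lemma free_module_induct [consumes 1, case_names zero step]:
  assumes v: "v \<in> carrier (free_module R J)"
    and zero: "Q \<zero>\<^bsub>free_module R J\<^esub>"
    and step: "\<And>c g w. \<lbrakk>c \<in> carrier R; g \<in> J; w \<in> carrier (free_module R J); Q w\<rbrakk> \<Longrightarrow>
      Q (c \<odot>\<^bsub>free_module R J\<^esub> free_basis R J g \<oplus>\<^bsub>free_module R J\<^esub> w)"
  shows "Q v"
proof -
  let ?F = "free_module R J"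
  have "finite {g \<in> J. v g \<noteq> \<zero>}"
    using v by (simp add: free_module_carrier)
  then show ?thesis
    using v
  proof (induction "{g \<in> J. v g \<noteq> \<zero>}" arbitrary: v rule: finite_induct)
    case empty
    then have "v = \<zero>\<^bsub>?F\<^esub>"
      by (intro ext) (auto simp: free_module_carrier vs_dsum_def vs_self_def PiE_iff extensional_def)
    then show ?case
      using zero by simp
  next
    case (insert g A)
    let ?w = "v(g := \<zero>)"
    have g: "g \<in> J" "v g \<in> carrier R"
      using insert by (auto simp: free_module_carrier)
    have A: "A = {h \<in> J. ?w h \<noteq> \<zero>}"
      using insert.hyps by auto
    have w: "?w \<in> carrier ?F"
      using insert.prems insert.hyps(1) g unfolding free_module_carrier A by (auto simp: PiE_iff extensional_def)
    have "v = v g \<odot>\<^bsub>?F\<^esub> free_basis R J g \<oplus>\<^bsub>?F\<^esub> ?w"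
      using insert.prems g
      by (intro ext) (auto simp: free_module_carrier vs_dsum_def vs_self_def free_basis_def PiE_iff extensional_def)
    then show ?case
      using step[OF g(2,1) w insert.hyps(3)[OF A w]] by simp
  qed
qed

end

section \<open>Congruence modulo a submodule\<close>

context module
begin

lemma submodule_cong:
  assumes H: "submodule H R M"
  shows submodule_cong_trans: "\<lbrakk>u \<ominus>\<^bsub>M\<^esub> v \<in> H; v \<ominus>\<^bsub>M\<^esub> w \<in> H; u \<in> carrier M; v \<in> carrier M; w \<in> carrier M\<rbrakk>
      \<Longrightarrow> u \<ominus>\<^bsub>M\<^esub> w \<in> H"
    and submodule_cong_sym: "\<lbrakk>u \<ominus>\<^bsub>M\<^esub> v \<in> H; u \<in> carrier M; v \<in> carrier M\<rbrakk> \<Longrightarrow> v \<ominus>\<^bsub>M\<^esub> u \<in> H"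
    and submodule_cong_add: "\<lbrakk>u \<ominus>\<^bsub>M\<^esub> v \<in> H; u' \<ominus>\<^bsub>M\<^esub> v' \<in> H; u \<in> carrier M; v \<in> carrier M; u' \<in> carrier M; v' \<in> carrier M\<rbrakk>
      \<Longrightarrow> (u \<oplus>\<^bsub>M\<^esub> u') \<ominus>\<^bsub>M\<^esub> (v \<oplus>\<^bsub>M\<^esub> v') \<in> H"
    and submodule_cong_smult: "\<lbrakk>u \<ominus>\<^bsub>M\<^esub> v \<in> H; c \<in> carrier R; u \<in> carrier M; v \<in> carrier M\<rbrakk>
      \<Longrightarrow> (c \<odot>\<^bsub>M\<^esub> u) \<ominus>\<^bsub>M\<^esub> (c \<odot>\<^bsub>M\<^esub> v) \<in> H"
    and submodule_cong_mem: "\<lbrakk>u \<ominus>\<^bsub>M\<^esub> v \<in> H; v \<in> H; u \<in> carrier M\<rbrakk> \<Longrightarrow> u \<in> H"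
proof -
  note E = submoduleE[OF H]
  show "u \<ominus>\<^bsub>M\<^esub> w \<in> H" if "u \<ominus>\<^bsub>M\<^esub> v \<in> H" "v \<ominus>\<^bsub>M\<^esub> w \<in> H" "u \<in> carrier M" "v \<in> carrier M" "w \<in> carrier M" for u v w
    using E(5)[OF that(1,2)] that(3-) by (simp add: M.minus_eq M.a_assoc M.r_neg1)
  show "v \<ominus>\<^bsub>M\<^esub> u \<in> H" if "u \<ominus>\<^bsub>M\<^esub> v \<in> H" "u \<in> carrier M" "v \<in> carrier M" for u v
    using E(3)[OF that(1)] that(2-) by (simp add: M.minus_eq M.minus_add M.a_comm)
  show "(u \<oplus>\<^bsub>M\<^esub> u') \<ominus>\<^bsub>M\<^esub> (v \<oplus>\<^bsub>M\<^esub> v') \<in> H"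
    if "u \<ominus>\<^bsub>M\<^esub> v \<in> H" "u' \<ominus>\<^bsub>M\<^esub> v' \<in> H" "u \<in> carrier M" "v \<in> carrier M" "u' \<in> carrier M" "v' \<in> carrier M" for u v u' v'
    using E(5)[OF that(1,2)] that(3-) by (simp add: M.minus_eq M.minus_add M.add.m_ac)
  show "(c \<odot>\<^bsub>M\<^esub> u) \<ominus>\<^bsub>M\<^esub> (c \<odot>\<^bsub>M\<^esub> v) \<in> H"
    if "u \<ominus>\<^bsub>M\<^esub> v \<in> H" "c \<in> carrier R" "u \<in> carrier M" "v \<in> carrier M" for u v c
    using E(4)[OF that(2,1)] that(2-) by (simp add: M.minus_eq smult_r_distr smult_r_minus)
  show "u \<in> H" if "u \<ominus>\<^bsub>M\<^esub> v \<in> H" "v \<in> H" "u \<in> carrier M" for u v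
    using E(5)[OF that(1,2)] that(2-) E(1) by (auto simp: M.minus_eq M.a_assoc M.l_neg)
qed

end

lemma vs_span_least: "\<lbrakk>submodule H K V; A \<subseteq> H\<rbrakk> \<Longrightarrow> vs_span K V A \<subseteq> H"
  by (auto simp: vs_span_def)

lemma vs_span_superset: "A \<subseteq> vs_span K V A"
  by (auto simp: vs_span_def)

lemma submodule_vs_span:
  assumes V: "module K V" and A: "A \<subseteq> carrier V"
  shows "submodule (vs_span K V A) K V"
proof (rule module.submoduleI[OF V])
  note E = module.submoduleE[OF V]
  show "vs_span K V A \<subseteq> carrier V"
    using vs_span_least[OF module.carrier_is_submodule[OF V] A] .
  show "\<zero>\<^bsub>V\<^esub> \<in> vs_span K V A"
    using subgroup.one_closed[OF submodule.axioms(1)] by (fastforce simp: vs_span_def)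
qed (use module.submoduleE[OF V] in \<open>auto simp: vs_span_def\<close>)

section \<open>Localization of modules embedded in a downset module\<close>

lemma group_closure_face:
  assumes \<tau>: "face Qp \<tau>" and z: "z \<in> group_closure \<tau>"
  shows "\<exists>u\<in>\<tau>. \<exists>v\<in>\<tau>. z = u - v"
  using z
proof (induction rule: group_closure.induct)
  case (base s)
  then have "s = s - 0" "s \<in> \<tau>" "0 \<in> \<tau>"
    using face_zero[OF \<tau>] by auto
  then show ?case by blast
next
  case (diff s t)
  then obtain u v u' v' where *: "u \<in> \<tau>" "v \<in> \<tau>" "u' \<in> \<tau>" "v' \<in> \<tau>" "s = u - v" "t = u' - v'"
    by blast
  then have "s - t = (u + v') - (v + u')"
    by (simp add: algebra_simps)
  then show ?case
    using * face_add[OF \<tau>] by blast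
qed

context po_group
begin

lemma face_cone_diff:
  assumes \<tau>: "face Qp \<tau>" and b: "b \<in> face_cone Qp \<tau>"
  shows "\<exists>p\<in>Qp. \<exists>z\<in>\<tau>. b = p - z"
proof -
  obtain p z where "p \<in> Qp" "z \<in> group_closure \<tau>" "b = p + z"
    using b by (auto simp: face_cone_def)
  moreover then obtain u v where "u \<in> \<tau>" "v \<in> \<tau>" "z = u - v"
    using group_closure_face[OF \<tau>] by blast
  ultimately have "b = (p + u) - v" "p + u \<in> Qp" "v \<in> \<tau>"
    using add_mem face_subset[OF \<tau>] by auto
  then show ?thesis by blast
qed

lemma face_cone_add: "\<lbrakk>b \<in> face_cone Qp \<tau>; p \<in> Qp\<rbrakk> \<Longrightarrow> b + p \<in> face_cone Qp \<tau>"
proof -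
  assume "b \<in> face_cone Qp \<tau>" "p \<in> Qp"
  then obtain p' z where "p' \<in> Qp" "z \<in> group_closure \<tau>" "b = p' + z"
    by (auto simp: face_cone_def)
  then have "b + p = (p' + p) + z" "p' + p \<in> Qp"
    using add_mem \<open>p \<in> Qp\<close> by (auto simp: algebra_simps)
  then show ?thesis
    using \<open>z \<in> group_closure \<tau>\<close> unfolding face_cone_def by blast
qed

lemma uminus_face_cone: "z \<in> \<tau> \<Longrightarrow> - z \<in> face_cone Qp \<tau>"
proof -
  assume "z \<in> \<tau>"
  then have "- z \<in> group_closure \<tau>"
    by (simp add: group_closure.base)
  moreover have "- z = 0 + - z" by simp
  ultimately show ?thesis
    using zero_mem unfolding face_cone_def by blast
qed

lemma zero_face_cone: "face Qp \<tau> \<Longrightarrow> 0 \<in> face_cone Qp \<tau>"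
  using uminus_face_cone[of 0 \<tau>] face_zero by force

text \<open>
  Writing \<open>b = p - z\<close> with \<open>p \<in> Qp\<close> and \<open>z \<in> \<tau>\<close> shows \<open>a\<close> to lie below \<open>(a + b) + z\<close>.  For tensors this
  means that in a degree of \<open>loc_downset \<tau> P\<close> the left factor of \<open>x \<otimes> y\<close> sits in a degree of \<open>P\<close> unless
  \<open>y = 0\<close>.
\<close>
lemma loc_downset_minus_face_cone:
  assumes P: "downset Qp P" and \<tau>: "face Qp \<tau>"
    and "a + b \<in> loc_downset \<tau> P" "b \<in> face_cone Qp \<tau>"
  shows "a \<in> P"
proof -
  obtain p z where pz: "p \<in> Qp" "z \<in> \<tau>" "b = p - z"
    using face_cone_diff assms(2,4) by blast
  then have "a + p \<in> P"
    using assms(3) by (auto simp: loc_downset_def)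
  then show ?thesis
    using P po_le_add[OF pz(1)] downsetD by blast
qed

end

text \<open>
  An embedding \<open>\<phi>\<close> of \<open>L\<close> into \<open>K[P]\<close> will be localized to an embedding of \<open>L \<otimes> K[Qp + Z\<tau>]\<close> into
  \<open>K[loc_downset \<tau> P]\<close>.
\<close>
locale localized_embedding = po_group Qp + K: cring K
  for Qp :: "'q::ab_group_add set" and K :: "('k, 'r) ring_scheme" +
  fixes L :: "('q, 'k, 'v) qmod" and P :: "'q set" and \<phi> :: "'q \<Rightarrow> 'v \<Rightarrow> 'k" and \<tau> :: "'q set"
  assumes emb: "downset_embedding K Qp L P \<phi>"
    and face: "face Qp \<tau>"
begin

abbreviation "cone_mod \<equiv> indicator_qmod K (face_cone Qp \<tau>)"
abbreviation "gens q \<equiv> tgens L cone_mod q"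
abbreviation "free q \<equiv> tfree K L cone_mod q"
abbreviation "ten q \<equiv> tbasis K L cone_mod q"
abbreviation "ker q \<equiv> tker K Qp L cone_mod q"

text \<open>
  On generators the localized embedding is \<open>x \<otimes> y \<mapsto> \<phi> x * y\<close>, cut off outside \<open>loc_downset \<tau> P\<close>.
\<close>
definition gen_form :: "'q \<Rightarrow> ('q, 'v, 'k) tgen \<Rightarrow> 'k" where
  "gen_form q g = (case g of (a, x, b, y) \<Rightarrow>
     if q \<in> loc_downset \<tau> P then \<phi> a x \<otimes>\<^bsub>K\<^esub> y else \<zero>\<^bsub>K\<^esub>)"

definition loc_form :: "'q \<Rightarrow> (('q, 'v, 'k) tgen \<Rightarrow> 'k) \<Rightarrow> 'k" where
  "loc_form q = free_extension K (gens q) (gen_form q)"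

lemmas P = downset_embeddingD(1)[OF emb K.cring_axioms]
  and L_module = downset_embeddingD(2)[OF emb K.cring_axioms]
  and L_mor_closed = downset_embeddingD(3)[OF emb K.cring_axioms]
  and \<phi>_linear = downset_embeddingD(4)[OF emb K.cring_axioms]
  and \<phi>_outside = downset_embeddingD(5)[OF emb K.cring_axioms]
  and \<phi>_mor = downset_embeddingD(6)[OF emb K.cring_axioms]
  and \<phi>_zero_iff = downset_embeddingD(7)[OF emb K.cring_axioms]

lemmas \<phi>_simps = module.linear_formD[OF L_module \<phi>_linear]

lemma cone_mod_closed: "y \<in> carrier (qpart cone_mod b) \<Longrightarrow> y \<in> carrier K"
  by (auto simp: indicator_qmod_def vs_self_def vs_zero_def split: if_splits)

lemma cone_mod_zero: "\<lbrakk>y \<in> carrier (qpart cone_mod b); b \<notin> face_cone Qp \<tau>\<rbrakk> \<Longrightarrow> y = \<zero>\<^bsub>K\<^esub>"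
  by (auto simp: indicator_qmod_def vs_zero_def)

lemma cone_mod_carrier: "b \<in> face_cone Qp \<tau> \<Longrightarrow> carrier (qpart cone_mod b) = carrier K"
  by (auto simp: indicator_qmod_def vs_self_def)

lemma cone_mod_ops: "y \<oplus>\<^bsub>qpart cone_mod b\<^esub> y' = y \<oplus>\<^bsub>K\<^esub> y'" "c \<odot>\<^bsub>qpart cone_mod b\<^esub> y = c \<otimes>\<^bsub>K\<^esub> y"
  by (auto simp: indicator_qmod_def vs_self_def vs_zero_def)

lemma cone_mod_op_closed:
  "\<lbrakk>y \<in> carrier (qpart cone_mod b); y' \<in> carrier (qpart cone_mod b)\<rbrakk> \<Longrightarrow>
     y \<oplus>\<^bsub>K\<^esub> y' \<in> carrier (qpart cone_mod b)"
  "\<lbrakk>y \<in> carrier (qpart cone_mod b); c \<in> carrier K\<rbrakk> \<Longrightarrow> c \<otimes>\<^bsub>K\<^esub> y \<in> carrier (qpart cone_mod b)"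
  by (auto simp: indicator_qmod_def vs_self_def vs_zero_def)

lemma cone_mod_mor:
  assumes y: "y \<in> carrier (qpart cone_mod b)" and p: "p \<in> Qp"
  shows "qmor cone_mod b (b + p) y = y" "y \<in> carrier (qpart cone_mod (b + p))"
proof -
  show "qmor cone_mod b (b + p) y = y"
    using face_cone_add[OF _ p, of b] cone_mod_zero[OF y] by (auto simp: indicator_qmod_def)
  show "y \<in> carrier (qpart cone_mod (b + p))"
    using face_cone_add[OF _ p, of b] cone_mod_zero[OF y] cone_mod_closed[OF y]
    by (auto simp: indicator_qmod_def vs_self_def vs_zero_def)
qed

lemma gens_iff:
  "(a, x, b, y) \<in> gens q \<longleftrightarrow> a + b = q \<and> x \<in> carrier (qpart L a) \<and> y \<in> carrier (qpart cone_mod b)"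
  by (simp add: tgens_def)

lemma ten_eq: "ten q g = free_basis K (gens q) g"
  by (simp add: tbasis_def free_basis_def)

lemma ten_closed: "ten q g \<in> carrier (free q)"
  unfolding ten_eq tfree_def by (rule K.free_basis_closed)

lemma free_module: "module K (free q)"
  unfolding tfree_def by (rule K.module_free_module)

lemma gen_form_closed: "gen_form q \<in> gens q \<rightarrow> carrier K"
  using \<phi>_simps(1) cone_mod_closed by (auto simp: gens_iff gen_form_def)

lemma loc_form_linear: "linear_form K (free q) (loc_form q)"
  unfolding loc_form_def tfree_def by (rule K.linear_form_free_extension[OF gen_form_closed])

lemmas loc_form_simps = module.linear_formD[OF free_module loc_form_linear]

lemma loc_form_ten: "g \<in> gens q \<Longrightarrow> loc_form q (ten q g) = gen_form q g"
  unfolding loc_form_def ten_eq by (rule K.free_extension_basis[OF gen_form_closed])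

lemma loc_form_outside: "q \<notin> loc_downset \<tau> P \<Longrightarrow> v \<in> carrier (free q) \<Longrightarrow> loc_form q v = \<zero>\<^bsub>K\<^esub>"
proof -
  assume "q \<notin> loc_downset \<tau> P" and v: "v \<in> carrier (free q)"
  then have "gen_form q g = \<zero>\<^bsub>K\<^esub>" for g
    by (auto simp: gen_form_def split: prod.split)
  then have "loc_form q v = (\<Oplus>\<^bsub>K\<^esub> g \<in> {g \<in> gens q. v g \<noteq> \<zero>\<^bsub>K\<^esub>}. \<zero>\<^bsub>K\<^esub>)"
    unfolding loc_form_def free_extension_def
    using v by (intro K.finsum_cong') (auto simp: tfree_def K.free_module_carrier PiE_iff)
  then show ?thesis
    by (simp add: K.finsum_zero)
qed

text \<open>
  The only relation that uses more than bilinearity is \<open>(t\<^sup>p x) \<otimes> y = x \<otimes> (t\<^sup>p y)\<close>.  It is respected because in a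
  degree of \<open>loc_downset \<tau> P\<close> either \<open>y = 0\<close> or the degree of \<open>t\<^sup>p x\<close> belongs to \<open>P\<close>, so that \<open>t\<^sup>p\<close> does not
  change the value of \<open>\<phi>\<close>.
\<close>
lemma trels_subset: "trels K Qp L cone_mod q \<subseteq> form_kernel K (free q) (loc_form q)"
proof
  interpret F: module K "free q" by (rule free_module)
  note simps = form_kernel_def loc_form_simps ten_closed loc_form_ten gens_iff gen_form_def
    \<phi>_simps cone_mod_closed cone_mod_ops cone_mod_op_closed K.l_distr K.r_distr K.minus_eq K.r_neg
    K.m_assoc K.m_lcomm
  fix r assume "r \<in> trels K Qp L cone_mod q"
  then show "r \<in> form_kernel K (free q) (loc_form q)"
  proof cases
    case (add_left a b x x' y)
    interpret La: module K "qpart L a" by (rule L_module)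
    show ?thesis
      using add_left by (auto simp: simps)
  next
    case (add_right a b x y y')
    then show ?thesis
      by (auto simp: simps)
  next
    case (smult_left a b x y c)
    interpret La: module K "qpart L a" by (rule L_module)
    show ?thesis
      using smult_left by (auto simp: simps)
  next
    case (smult_right a b x y c)
    then show ?thesis
      by (auto simp: simps)
  next
    case (balanced p a b x y)
    have le: "po_le Qp a (a + p)"
      using po_le_add[OF balanced(2)] .
    have g1: "(a + p, qmor L a (a + p) x, b, y) \<in> gens q"
      using balanced L_mor_closed[OF le] by (simp add: gens_iff)
    have g2: "(a, x, b + p, qmor cone_mod b (b + p) y) \<in> gens q"
      using balanced cone_mod_mor[OF balanced(5,2)] by (simp add: gens_iff algebra_simps)
    have "\<phi> (a + p) (qmor L a (a + p) x) \<otimes>\<^bsub>K\<^esub> y = \<phi> a x \<otimes>\<^bsub>K\<^esub> y" if q: "q \<in> loc_downset \<tau> P"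
    proof (cases "b \<in> face_cone Qp \<tau>")
      case True
      then have "a + p \<in> P"
        using loc_downset_minus_face_cone[OF P face _ True] q balanced(3) by blast
      then show ?thesis
        using \<phi>_mor[OF le balanced(4)] by simp
    next
      case False
      then show ?thesis
        using cone_mod_zero[OF balanced(5)] \<phi>_simps(1) L_mor_closed[OF le] balanced(4) by simp
    qed
    then have "gen_form q (a + p, qmor L a (a + p) x, b, y) =
        gen_form q (a, x, b + p, qmor cone_mod b (b + p) y)"
      using cone_mod_mor[OF balanced(5,2)] by (simp add: gen_form_def)
    then show ?thesis
      using g1 g2 gen_form_closed balanced(1)
      by (auto simp: form_kernel_def loc_form_simps ten_closed loc_form_ten K.minus_eq K.r_neg Pi_iff)
  qed
qed

lemma ker_submodule: "submodule (ker q) K (free q)"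
  unfolding tker_def
  by (rule submodule_vs_span[OF free_module]) (use trels_subset in \<open>auto simp: form_kernel_def\<close>)

lemma trels_ker: "trels K Qp L cone_mod q \<subseteq> ker q"
  unfolding tker_def by (rule vs_span_superset)

text \<open>
  The fraction \<open>x / t\<^sup>z\<close>, for \<open>z \<in> \<tau>\<close> and \<open>x\<close> in degree \<open>q + z\<close>.
\<close>
definition frac :: "'q \<Rightarrow> 'q \<Rightarrow> 'v \<Rightarrow> ('q, 'v, 'k) tgen \<Rightarrow> 'k" where
  "frac q z x = ten q (q + z, x, - z, \<one>\<^bsub>K\<^esub>)"

definition cong :: "'q \<Rightarrow> (('q, 'v, 'k) tgen \<Rightarrow> 'k) \<Rightarrow> (('q, 'v, 'k) tgen \<Rightarrow> 'k) \<Rightarrow> bool" where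
  "cong q u v \<longleftrightarrow> u \<in> carrier (free q) \<and> v \<in> carrier (free q) \<and> u \<ominus>\<^bsub>free q\<^esub> v \<in> ker q"

lemma cong_trans: "cong q u v \<Longrightarrow> cong q v w \<Longrightarrow> cong q u w"
  unfolding cong_def by (meson module.submodule_cong_trans[OF free_module ker_submodule])

lemma cong_sym: "cong q u v \<Longrightarrow> cong q v u"
  unfolding cong_def by (meson module.submodule_cong_sym[OF free_module ker_submodule])

lemma cong_add: "cong q u v \<Longrightarrow> cong q u' v' \<Longrightarrow> cong q (u \<oplus>\<^bsub>free q\<^esub> u') (v \<oplus>\<^bsub>free q\<^esub> v')"
proof -
  interpret F: module K "free q" by (rule free_module)
  show "cong q u v \<Longrightarrow> cong q u' v' \<Longrightarrow> cong q (u \<oplus>\<^bsub>free q\<^esub> u') (v \<oplus>\<^bsub>free q\<^esub> v')"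
    unfolding cong_def using F.submodule_cong_add[OF ker_submodule] by simp
qed

lemma cong_smult: "cong q u v \<Longrightarrow> c \<in> carrier K \<Longrightarrow> cong q (c \<odot>\<^bsub>free q\<^esub> u) (c \<odot>\<^bsub>free q\<^esub> v)"
proof -
  interpret F: module K "free q" by (rule free_module)
  show "cong q u v \<Longrightarrow> c \<in> carrier K \<Longrightarrow> cong q (c \<odot>\<^bsub>free q\<^esub> u) (c \<odot>\<^bsub>free q\<^esub> v)"
    unfolding cong_def using F.submodule_cong_smult[OF ker_submodule] by simp
qed

lemma cong_mem: "cong q u v \<Longrightarrow> v \<in> ker q \<Longrightarrow> u \<in> ker q"
  unfolding cong_def by (meson module.submodule_cong_mem[OF free_module ker_submodule])

lemma cong_rel: "u \<ominus>\<^bsub>free q\<^esub> v \<in> trels K Qp L cone_mod q \<Longrightarrow> u \<in> carrier (free q) \<Longrightarrow> v \<in> carrier (free q) \<Longrightarrow> cong q u v"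
  unfolding cong_def using trels_ker by blast

text \<open>
  Expanding a fraction by \<open>t\<^sup>w\<close>.
\<close>
lemma frac_shift:
  assumes "z \<in> \<tau>" "w \<in> \<tau>" "x \<in> carrier (qpart L (q + z))"
  shows "cong q (frac q z x) (frac q (z + w) (qmor L (q + z) (q + (z + w)) x))"
proof -
  have zw: "- (z + w) \<in> face_cone Qp \<tau>"
    using uminus_face_cone face_add[OF face assms(1,2)] by blast
  have w: "w \<in> Qp"
    using face_subset[OF face] assms(2) by blast
  have one: "\<one>\<^bsub>K\<^esub> \<in> carrier (qpart cone_mod (- (z + w)))"
    unfolding cone_mod_carrier[OF zw] by simp
  have "ten q (q + z + w, qmor L (q + z) (q + z + w) x, - (z + w), \<one>\<^bsub>K\<^esub>) \<ominus>\<^bsub>free q\<^esub>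
      ten q (q + z, x, - (z + w) + w, qmor cone_mod (- (z + w)) (- (z + w) + w) \<one>\<^bsub>K\<^esub>)
      \<in> trels K Qp L cone_mod q"
    by (rule trels.balanced[OF w _ assms(3) one]) simp
  then have "cong q (frac q (z + w) (qmor L (q + z) (q + (z + w)) x)) (frac q z x)"
    using cone_mod_mor(1)[OF one w] unfolding frac_def by (intro cong_rel ten_closed) (simp add: add.assoc)
  then show ?thesis
    by (rule cong_sym)
qed

lemma frac_zero:
  assumes z: "z \<in> \<tau>"
  shows "cong q (frac q z \<zero>\<^bsub>qpart L (q + z)\<^esub>) \<zero>\<^bsub>free q\<^esub>"
proof -
  interpret F: module K "free q" by (rule free_module)
  interpret Lz: module K "qpart L (q + z)" by (rule L_module)
  let ?z = "\<zero>\<^bsub>qpart L (q + z)\<^esub>"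
  have "ten q (q + z, \<zero>\<^bsub>K\<^esub> \<odot>\<^bsub>qpart L (q + z)\<^esub> ?z, - z, \<one>\<^bsub>K\<^esub>) \<ominus>\<^bsub>free q\<^esub>
      (\<zero>\<^bsub>K\<^esub> \<odot>\<^bsub>free q\<^esub> ten q (q + z, ?z, - z, \<one>\<^bsub>K\<^esub>)) \<in> trels K Qp L cone_mod q"
    by (rule trels.smult_left) (simp_all add: cone_mod_carrier[OF uminus_face_cone[OF z]])
  then show ?thesis
    using ten_closed unfolding frac_def by (intro cong_rel) simp_all
qed

text \<open>
  Addition of fractions with the common denominator \<open>t\<close> to the power \<open>z + w\<close>.
\<close>
lemma frac_add:
  assumes z: "z \<in> \<tau>" "x \<in> carrier (qpart L (q + z))" "w \<in> \<tau>" "y \<in> carrier (qpart L (q + w))"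
  shows "\<exists>u\<in>\<tau>. \<exists>s\<in>carrier (qpart L (q + u)). cong q (frac q z x \<oplus>\<^bsub>free q\<^esub> frac q w y) (frac q u s)"
proof -
  interpret F: module K "free q" by (rule free_module)
  interpret Lu: module K "qpart L (q + (z + w))" by (rule L_module)
  let ?u = "z + w"
  let ?x = "qmor L (q + z) (q + ?u) x" and ?y = "qmor L (q + w) (q + ?u) y"
  have u: "?u \<in> \<tau>"
    by (rule face_add[OF face z(1,3)])
  have "po_le Qp (q + z) (q + ?u)" "po_le Qp (q + w) (q + ?u)"
    using face_subset[OF face] z by (auto simp: po_le_def)
  then have xy: "?x \<in> carrier (qpart L (q + ?u))" "?y \<in> carrier (qpart L (q + ?u))"
    using L_mor_closed z by auto
  have "cong q (frac q z x) (frac q ?u ?x)" "cong q (frac q w y) (frac q ?u ?y)"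
    using frac_shift[OF z(1,3,2)] frac_shift[OF z(3,1,4)] by (simp_all add: add.commute)
  then have "cong q (frac q z x \<oplus>\<^bsub>free q\<^esub> frac q w y) (frac q ?u ?x \<oplus>\<^bsub>free q\<^esub> frac q ?u ?y)"
    by (rule cong_add)
  moreover have "cong q (frac q ?u (?x \<oplus>\<^bsub>qpart L (q + ?u)\<^esub> ?y)) (frac q ?u ?x \<oplus>\<^bsub>free q\<^esub> frac q ?u ?y)"
    unfolding frac_def
    by (intro cong_rel trels.add_left F.M.a_closed ten_closed xy;
        (unfold cone_mod_carrier[OF uminus_face_cone[OF u]])?; simp)
  ultimately have "cong q (frac q z x \<oplus>\<^bsub>free q\<^esub> frac q w y) (frac q ?u (?x \<oplus>\<^bsub>qpart L (q + ?u)\<^esub> ?y))"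
    using cong_trans cong_sym by blast
  then show ?thesis
    using u xy by blast
qed

lemma frac_smult:
  assumes z: "z \<in> \<tau>" "x \<in> carrier (qpart L (q + z))" and c: "c \<in> carrier K"
  shows "cong q (c \<odot>\<^bsub>free q\<^esub> frac q z x) (frac q z (c \<odot>\<^bsub>qpart L (q + z)\<^esub> x))"
proof -
  interpret F: module K "free q" by (rule free_module)
  show ?thesis
    unfolding frac_def
    by (intro cong_sym[OF cong_rel] trels.smult_left F.smult_closed ten_closed z c)
       (simp_all add: cone_mod_carrier[OF uminus_face_cone[OF z(1)]])
qed

text \<open>
  If \<open>b = p - z\<close> with \<open>p \<in> Qp\<close> and \<open>z \<in> \<tau>\<close>, then the scalar \<open>y\<close> and the monomial \<open>t\<^sup>p\<close> can be moved to the left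
  factor, which leaves the denominator \<open>t\<^sup>z\<close> on the right.  For \<open>b\<close> outside the cone the right factor is zero.
\<close>
lemma ten_cong_frac:
  assumes "(a, x, b, y) \<in> gens q"
  shows "\<exists>z\<in>\<tau>. \<exists>s\<in>carrier (qpart L (q + z)). cong q (ten q (a, x, b, y)) (frac q z s)"
proof (cases "b \<in> face_cone Qp \<tau>")
  case True
  interpret F: module K "free q" by (rule free_module)
  interpret La: module K "qpart L a" by (rule L_module)
  obtain p z where pz: "p \<in> Qp" "z \<in> \<tau>" "b = - z + p"
    using face_cone_diff[OF face True] by auto
  have ab: "a + b = q" "x \<in> carrier (qpart L a)" "y \<in> carrier K"
    using assms cone_mod_closed by (auto simp: gens_iff)
  have ap: "a + p = q + z"
    using ab(1) pz(3) by (auto simp: algebra_simps)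
  have one: "\<one>\<^bsub>K\<^esub> \<in> carrier (qpart cone_mod (- z))"
    by (simp add: cone_mod_carrier[OF uminus_face_cone[OF pz(2)]])
  let ?x = "y \<odot>\<^bsub>qpart L a\<^esub> x"
  have yx: "?x \<in> carrier (qpart L a)"
    using ab by simp
  have "cong q (ten q (a, x, b, y \<odot>\<^bsub>qpart cone_mod b\<^esub> \<one>\<^bsub>K\<^esub>)) (y \<odot>\<^bsub>free q\<^esub> ten q (a, x, b, \<one>\<^bsub>K\<^esub>))"
    using ab by (intro cong_rel trels.smult_right F.smult_closed ten_closed) (simp_all add: cone_mod_carrier[OF True])
  then have "cong q (ten q (a, x, b, y)) (y \<odot>\<^bsub>free q\<^esub> ten q (a, x, b, \<one>\<^bsub>K\<^esub>))"
    using ab by (simp add: cone_mod_ops)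
  moreover have "cong q (ten q (a, ?x, b, \<one>\<^bsub>K\<^esub>)) (y \<odot>\<^bsub>free q\<^esub> ten q (a, x, b, \<one>\<^bsub>K\<^esub>))"
    using ab by (intro cong_rel trels.smult_left F.smult_closed ten_closed) (simp_all add: cone_mod_carrier[OF True])
  moreover have "cong q (frac q z (qmor L a (a + p) ?x)) (ten q (a, ?x, b, \<one>\<^bsub>K\<^esub>))"
  proof -
    have "ten q (a + p, qmor L a (a + p) ?x, - z, \<one>\<^bsub>K\<^esub>) \<ominus>\<^bsub>free q\<^esub>
        ten q (a, ?x, - z + p, qmor cone_mod (- z) (- z + p) \<one>\<^bsub>K\<^esub>) \<in> trels K Qp L cone_mod q"
      by (rule trels.balanced[OF pz(1) _ yx one]) (simp add: ap)
    moreover have "qmor cone_mod (- z) b \<one>\<^bsub>K\<^esub> = \<one>\<^bsub>K\<^esub>"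
      unfolding pz(3) by (rule cone_mod_mor(1)[OF one pz(1)])
    ultimately show ?thesis
      unfolding frac_def pz(3)[symmetric] ap by (intro cong_rel ten_closed) simp
  qed
  ultimately have "cong q (ten q (a, x, b, y)) (frac q z (qmor L a (a + p) ?x))"
    using cong_trans cong_sym by blast
  moreover have "qmor L a (a + p) ?x \<in> carrier (qpart L (q + z))"
    using L_mor_closed[OF po_le_add[OF pz(1)] yx] by (simp add: ap)
  ultimately show ?thesis
    using pz(2) by blast
next
  case False
  interpret F: module K "free q" by (rule free_module)
  interpret L0: module K "qpart L (q + 0)" by (rule L_module)
  have y: "y = \<zero>\<^bsub>K\<^esub>"
    using assms False cone_mod_zero by (auto simp: gens_iff)
  have "cong q (ten q (a, x, b, \<zero>\<^bsub>K\<^esub> \<odot>\<^bsub>qpart cone_mod b\<^esub> y)) (\<zero>\<^bsub>K\<^esub> \<odot>\<^bsub>free q\<^esub> ten q (a, x, b, y))"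
    using assms by (intro cong_rel trels.smult_right F.smult_closed ten_closed) (simp_all add: gens_iff)
  then have "cong q (ten q (a, x, b, y)) \<zero>\<^bsub>free q\<^esub>"
    using ten_closed by (simp add: cone_mod_ops y)
  then show ?thesis
    using cong_trans cong_sym[OF frac_zero[OF face_zero[OF face]]] face_zero[OF face] by blast
qed

lemma free_cong_frac:
  assumes "v \<in> carrier (free q)"
  shows "\<exists>z\<in>\<tau>. \<exists>x\<in>carrier (qpart L (q + z)). cong q v (frac q z x)"
  using assms unfolding tfree_def
proof (induction rule: K.free_module_induct)
  case zero
  interpret L0: module K "qpart L (q + 0)" by (rule L_module)
  show ?case
    using cong_sym[OF frac_zero[OF face_zero[OF face]]] face_zero[OF face]
    unfolding tfree_def by blast
next
  case (step c g w)
  obtain a x b y where g: "g = (a, x, b, y)"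
    by (cases g)
  obtain z s where z: "z \<in> \<tau>" "s \<in> carrier (qpart L (q + z))" "cong q (ten q g) (frac q z s)"
    using ten_cong_frac step(2) unfolding g by blast
  obtain z' s' where z': "z' \<in> \<tau>" "s' \<in> carrier (qpart L (q + z'))" "cong q w (frac q z' s')"
    using step by blast
  have cs: "c \<odot>\<^bsub>qpart L (q + z)\<^esub> s \<in> carrier (qpart L (q + z))"
    using module.smult_closed[OF L_module] step(1) z(2) by blast
  have "cong q (c \<odot>\<^bsub>free q\<^esub> ten q g) (frac q z (c \<odot>\<^bsub>qpart L (q + z)\<^esub> s))"
    using cong_trans[OF cong_smult[OF z(3) step(1)] frac_smult[OF z(1,2) step(1)]] .
  then have "cong q (c \<odot>\<^bsub>free q\<^esub> ten q g \<oplus>\<^bsub>free q\<^esub> w)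
      (frac q z (c \<odot>\<^bsub>qpart L (q + z)\<^esub> s) \<oplus>\<^bsub>free q\<^esub> frac q z' s')"
    using z'(3) by (rule cong_add)
  then show ?case
    using frac_add[OF z(1) cs z'(1,2)] cong_trans unfolding ten_eq tfree_def by blast
qed

text \<open>
  The tensor relations generate the whole kernel of the form.  Modulo the relations an element of the
  kernel is a fraction \<open>x / t\<^sup>z\<close>.  In a degree of \<open>loc_downset \<tau> P\<close> the form takes it to \<open>\<phi> x\<close>, so \<open>x = 0\<close> by
  injectivity of \<open>\<phi>\<close>.  In any other degree some \<open>w \<in> \<tau>\<close> leads out of \<open>P\<close>, so \<open>t\<^sup>w x = 0\<close>, and expanding by
  \<open>t\<^sup>w\<close> shows the fraction to vanish.
\<close>
lemma ker_eq: "ker q = form_kernel K (free q) (loc_form q)"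
proof
  show sub: "ker q \<subseteq> form_kernel K (free q) (loc_form q)"
    unfolding tker_def
    by (rule vs_span_least[OF module.submodule_form_kernel[OF free_module loc_form_linear] trels_subset])
  show "form_kernel K (free q) (loc_form q) \<subseteq> ker q"
  proof
    interpret F: module K "free q" by (rule free_module)
    fix v assume v: "v \<in> form_kernel K (free q) (loc_form q)"
    obtain z x where z: "z \<in> \<tau>" and x: "x \<in> carrier (qpart L (q + z))" and vx: "cong q v (frac q z x)"
      using free_cong_frac v unfolding form_kernel_def by blast
    interpret Lz: module K "qpart L (q + z)" by (rule L_module)
    have "frac q z x \<in> form_kernel K (free q) (loc_form q)"
      using F.submodule_cong_mem[OF F.submodule_form_kernel[OF loc_form_linear]]
        cong_sym[OF vx] sub v unfolding cong_def by blast
    moreover have "loc_form q (frac q z x) = (if q \<in> loc_downset \<tau> P then \<phi> (q + z) x else \<zero>\<^bsub>K\<^esub>)"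
    proof -
      have "(q + z, x, - z, \<one>\<^bsub>K\<^esub>) \<in> gens q"
        using x by (simp add: gens_iff cone_mod_carrier[OF uminus_face_cone[OF z]])
      then show ?thesis
        using x \<phi>_simps(1) by (simp add: frac_def loc_form_ten gen_form_def)
    qed
    ultimately have val: "(if q \<in> loc_downset \<tau> P then \<phi> (q + z) x else \<zero>\<^bsub>K\<^esub>) = \<zero>\<^bsub>K\<^esub>"
      by (simp add: form_kernel_def)
    have "cong q (frac q z x) \<zero>\<^bsub>free q\<^esub>"
    proof (cases "q \<in> loc_downset \<tau> P")
      case True
      then show ?thesis
        using val \<phi>_zero_iff[OF x] frac_zero[OF z] by simp
    next
      case False
      then obtain w where w: "w \<in> \<tau>" "q + w \<notin> P"
        by (auto simp: loc_downset_def)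
      have le: "po_le Qp (q + w) (q + (z + w))" "po_le Qp (q + z) (q + (z + w))"
        using face_subset[OF face] z w by (auto simp: po_le_def)
      have c: "qmor L (q + z) (q + (z + w)) x \<in> carrier (qpart L (q + (z + w)))"
        by (rule L_mor_closed[OF le(2) x])
      have "q + (z + w) \<notin> P"
        using downsetD[OF P le(1)] w(2) by blast
      then have "qmor L (q + z) (q + (z + w)) x = \<zero>\<^bsub>qpart L (q + (z + w))\<^esub>"
        using \<phi>_outside[OF _ c] \<phi>_zero_iff[OF c] by blast
      then show ?thesis
        using frac_shift[OF z w(1) x] frac_zero[OF face_add[OF face z w(1)]] cong_trans by metis
    qed
    then have "cong q v \<zero>\<^bsub>free q\<^esub>"
      using vx cong_trans by blast
    then show "v \<in> ker q"
      using cong_mem subgroup.one_closed[OF submodule.axioms(1)[OF ker_submodule]] by fastforce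
  qed
qed

lemma tpush_form:
  assumes le: "po_le Qp q q'" and v: "v \<in> carrier (free q)"
  shows "tpush K L cone_mod q q' v \<in> carrier (free q')"
    and "loc_form q' (tpush K L cone_mod q q' v) = (if q' \<in> loc_downset \<tau> P then loc_form q v else \<zero>\<^bsub>K\<^esub>)"
proof -
  interpret F: module K "free q'" by (rule free_module)
  let ?S = "{g \<in> gens q. v g \<noteq> \<zero>\<^bsub>K\<^esub>}"
  \<comment> \<open>The effect on generators of multiplication by \<open>t\<close> to the power \<open>q' - q\<close>.\<close>
  define sh where "sh g = (case g of (a, x, b, y) \<Rightarrow> (a + (q' - q), qmor L a (a + (q' - q)) x, b, y))"
    for g :: "('q, 'v, 'k) tgen"
  have push: "tpush K L cone_mod q q' v = (\<Oplus>\<^bsub>free q'\<^esub> g \<in> ?S. v g \<odot>\<^bsub>free q'\<^esub> ten q' (sh g))"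
    unfolding tpush_def sh_def by (simp add: case_prod_beta)
  have fin: "finite ?S" and vK: "\<And>g. g \<in> gens q \<Longrightarrow> v g \<in> carrier K"
    using v by (auto simp: tfree_def K.free_module_carrier)
  have terms: "(\<lambda>g. v g \<odot>\<^bsub>free q'\<^esub> ten q' (sh g)) \<in> ?S \<rightarrow> carrier (free q')"
    using vK ten_closed by auto
  show c: "tpush K L cone_mod q q' v \<in> carrier (free q')"
    unfolding push by (rule F.M.finsum_closed[OF terms])
  have le': "po_le Qp a (a + (q' - q))" for a
    using le by (simp add: po_le_def)
  have sh: "sh g \<in> gens q'" if "g \<in> gens q" for g
    using that L_mor_closed[OF le'] by (auto simp: sh_def gens_iff algebra_simps split: prod.splits)
  have gen: "gen_form q' (sh g) = gen_form q g" if g: "g \<in> gens q" and q': "q' \<in> loc_downset \<tau> P" for g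
  proof -
    obtain a x b y where [simp]: "g = (a, x, b, y)"
      by (cases g)
    have ab: "a + b = q" and x: "x \<in> carrier (qpart L a)" and y: "y \<in> carrier (qpart cone_mod b)"
      using g by (auto simp: gens_iff)
    have q: "q \<in> loc_downset \<tau> P"
      using downsetD[OF downset_loc_downset[OF P] le q'] .
    have "\<phi> (a + (q' - q)) (qmor L a (a + (q' - q)) x) \<otimes>\<^bsub>K\<^esub> y = \<phi> a x \<otimes>\<^bsub>K\<^esub> y"
    proof (cases "b \<in> face_cone Qp \<tau>")
      case True
      have "a + (q' - q) + b \<in> loc_downset \<tau> P"
        using q' ab by (auto simp: algebra_simps)
      then show ?thesis
        using loc_downset_minus_face_cone[OF P face _ True] \<phi>_mor[OF le' x] by simp
    next
      case False
      then show ?thesis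
        using cone_mod_zero[OF y] \<phi>_simps(1) L_mor_closed[OF le' x] x by simp
    qed
    then show ?thesis
      using q q' by (simp add: sh_def gen_form_def)
  qed
  have "loc_form q' (tpush K L cone_mod q q' v) = (\<Oplus>\<^bsub>K\<^esub> g \<in> ?S. loc_form q' (v g \<odot>\<^bsub>free q'\<^esub> ten q' (sh g)))"
    unfolding push by (rule F.linear_form_finsum[OF loc_form_linear fin terms])
  also have "\<dots> = (\<Oplus>\<^bsub>K\<^esub> g \<in> ?S. v g \<otimes>\<^bsub>K\<^esub> gen_form q' (sh g))"
    using vK sh gen_form_closed
    by (intro K.finsum_cong') (auto simp: loc_form_simps ten_closed loc_form_ten Pi_iff)
  finally have eq: "loc_form q' (tpush K L cone_mod q q' v) = (\<Oplus>\<^bsub>K\<^esub> g \<in> ?S. v g \<otimes>\<^bsub>K\<^esub> gen_form q' (sh g))" .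
  show "loc_form q' (tpush K L cone_mod q q' v) = (if q' \<in> loc_downset \<tau> P then loc_form q v else \<zero>\<^bsub>K\<^esub>)"
  proof (cases "q' \<in> loc_downset \<tau> P")
    case True
    have "(\<Oplus>\<^bsub>K\<^esub> g \<in> ?S. v g \<otimes>\<^bsub>K\<^esub> gen_form q' (sh g)) = (\<Oplus>\<^bsub>K\<^esub> g \<in> ?S. v g \<otimes>\<^bsub>K\<^esub> gen_form q g)"
      using vK gen_form_closed gen[OF _ True] by (intro K.finsum_cong') (auto simp: Pi_iff)
    then show ?thesis
      using True eq by (simp add: loc_form_def free_extension_def)
  next
    case False
    then show ?thesis
      using loc_form_outside[OF False c] by simp
  qed
qed

text \<open>
  With the kernel known, the tensor product is a quotient by kernels of linear forms.  Injectivity of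
  \<open>\<psi>\<close> reduces every question about the localization map to the values of \<open>\<phi>\<close>.
\<close>
lemma downset_embedding_localization:
  defines "\<psi> \<equiv> \<lambda>q X. the_elem (loc_form q ` X)"
  shows "downset_embedding K Qp (localization K Qp \<tau> L) (loc_downset \<tau> P) \<psi>"
    and "x \<in> carrier (qpart L q) \<Longrightarrow> loc_map K Qp \<tau> L q x \<in> carrier (qpart (localization K Qp \<tau> L) q)"
    and "x \<in> carrier (qpart L q) \<Longrightarrow>
      \<psi> q (loc_map K Qp \<tau> L q x) = (if q \<in> loc_downset \<tau> P then \<phi> q x else \<zero>\<^bsub>K\<^esub>)"
proof -
  note emb' = qmodule_quotient_by_form_kernels[OF K.cring_axioms downset_loc_downset[OF P] free_module
      loc_form_linear loc_form_outside tpush_form po_le_refl po_le_trans ker_eq]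
  show "downset_embedding K Qp (localization K Qp \<tau> L) (loc_downset \<tau> P) \<psi>"
    unfolding localization_def qtensor_def \<psi>_def by (rule emb'(1))
  have map: "loc_map K Qp \<tau> L q x = ker q +>\<^bsub>free q\<^esub> ten q (q, x, 0, \<one>\<^bsub>K\<^esub>)"
    by (simp add: loc_map_def Let_def)
  show "loc_map K Qp \<tau> L q x \<in> carrier (qpart (localization K Qp \<tau> L) q)"
    unfolding map localization_def qtensor_def using ten_closed by (simp add: vs_quot_def A_RCOSETS_def') blast
  assume x: "x \<in> carrier (qpart L q)"
  have g: "(q, x, 0, \<one>\<^bsub>K\<^esub>) \<in> gens q"
    using x by (simp add: gens_iff cone_mod_carrier[OF zero_face_cone[OF face]])
  show "\<psi> q (loc_map K Qp \<tau> L q x) = (if q \<in> loc_downset \<tau> P then \<phi> q x else \<zero>\<^bsub>K\<^esub>)"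
    unfolding map \<psi>_def using vs_quot_form_kernel(5)[OF free_module loc_form_linear ten_closed, folded ker_eq] loc_form_ten[OF g] \<phi>_simps(1)[OF x]
    by (simp add: gen_form_def)
qed

end

section \<open>Coprimary modules\<close>

text \<open>
  By stability of \<open>P\<close> the localization along \<open>\<tau>\<close> embeds in the same \<open>K[P]\<close>, compatibly with the
  localization map, which is therefore injective.  Localizing once more, along \<open>\<tau>'\<close>, kills a nonzero element
  of degree \<open>q\<close> iff \<open>q\<close> is not in \<open>loc_downset \<tau>' P\<close>; so the part supported on \<open>\<tau>\<close> consists of the zero
  elements and the elements of certain good degrees.  Every nonzero element lies in a degree of \<open>P\<close>, above
  which there is a good degree in \<open>P\<close>, and it remains nonzero there.
\<close>
lemma (in po_group) coprimary_if_downset_embedding: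
  assumes K: "cring K" and emb: "downset_embedding K Qp L P \<phi>"
    and \<tau>: "face Qp \<tau>" and cop: "coprimary_downset Qp \<tau> P"
  shows "coprimary K Qp L"
proof -
  interpret L: localized_embedding Qp K L P \<phi> \<tau>
    by (intro localized_embedding.intro po_group_axioms K localized_embedding_axioms.intro emb \<tau>)
  let ?M = "localization K Qp \<tau> L"
  have stable: "loc_downset \<tau> P = P"
    using cop by (simp add: coprimary_downset_def)
  obtain \<psi> where emb1: "downset_embedding K Qp ?M P \<psi>"
    and \<psi>: "\<And>q x. x \<in> carrier (qpart L q) \<Longrightarrow>
      \<psi> q (loc_map K Qp \<tau> L q x) = (if q \<in> P then \<phi> q x else \<zero>\<^bsub>K\<^esub>)"
    using L.downset_embedding_localization unfolding stable by blast
  note M = downset_embeddingD[OF emb1 K]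
  define good where "good q \<longleftrightarrow> (\<forall>\<tau>'. face Qp \<tau>' \<and> \<not> \<tau>' \<subseteq> \<tau> \<longrightarrow> q \<notin> loc_downset \<tau>' P)" for q
  have good_up: "good q'" if "good q" "po_le Qp q q'" for q q'
    using that downsetD[OF downset_loc_downset[OF M(1)]] unfolding good_def by blast
  have inj: "qinjective L (loc_map K Qp \<tau> L)"
    unfolding qinjective_def
  proof (intro allI inj_onI)
    fix q x y assume xy: "x \<in> carrier (qpart L q)" "y \<in> carrier (qpart L q)"
      and "loc_map K Qp \<tau> L q x = loc_map K Qp \<tau> L q y"
    then have "(if q \<in> P then \<phi> q x else \<zero>\<^bsub>K\<^esub>) = (if q \<in> P then \<phi> q y else \<zero>\<^bsub>K\<^esub>)"
      using \<psi> by metis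
    then have "\<phi> q x = \<phi> q y"
      using L.\<phi>_outside xy by (metis (full_types))
    moreover have "inj_on (\<phi> q) (carrier (qpart L q))"
      using emb by (simp add: downset_embedding_def qinjective_def)
    ultimately show "x = y"
      using xy by (auto dest: inj_onD)
  qed
  have loc_zero: "loc_map K Qp \<tau>' ?M q x = \<zero>\<^bsub>qpart (localization K Qp \<tau>' ?M) q\<^esub> \<longleftrightarrow>
      q \<notin> loc_downset \<tau>' P \<or> x = \<zero>\<^bsub>qpart ?M q\<^esub>"
    if x: "x \<in> carrier (qpart ?M q)" and \<tau>': "face Qp \<tau>'" for q x \<tau>'
  proof -
    interpret M: localized_embedding Qp K ?M P \<psi> \<tau>'
      by (intro localized_embedding.intro po_group_axioms K localized_embedding_axioms.intro emb1 \<tau>')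
    note loc = M.downset_embedding_localization
    show ?thesis
      unfolding downset_embeddingD(7)[OF loc(1) K loc(2)[OF x], symmetric] loc(3)[OF x]
      using M(7)[OF x] by simp
  qed
  have support: "global_support K Qp \<tau> ?M q =
      {x \<in> carrier (qpart ?M q). good q \<or> x = \<zero>\<^bsub>qpart ?M q\<^esub>}" for q
    using loc_zero unfolding global_support_def good_def by blast
  have sub: "qsubmodule K Qp (global_support K Qp \<tau> ?M) ?M"
    unfolding qsubmodule_def
  proof (intro conjI allI impI)
    fix q
    interpret Mq: module K "qpart ?M q" by (rule M(2))
    show "submodule (global_support K Qp \<tau> ?M q) K (qpart ?M q)"
      unfolding support by (rule Mq.submoduleI) auto
  next
    fix q q' assume le: "po_le Qp q q'"
    show "qmor ?M q q' ` global_support K Qp \<tau> ?M q \<subseteq> global_support K Qp \<tau> ?M q'"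
    proof
      fix y assume "y \<in> qmor ?M q q' ` global_support K Qp \<tau> ?M q"
      then obtain x where x: "x \<in> carrier (qpart ?M q)" "good q \<or> x = \<zero>\<^bsub>qpart ?M q\<^esub>"
          and y: "y = qmor ?M q q' x"
        unfolding support by blast
      have yc: "y \<in> carrier (qpart ?M q')"
        unfolding y by (rule M(3)[OF le x(1)])
      have "y = \<zero>\<^bsub>qpart ?M q'\<^esub>" if "x = \<zero>\<^bsub>qpart ?M q\<^esub>"
      proof -
        have "\<psi> q x = \<zero>\<^bsub>K\<^esub>"
          using that M(7)[OF x(1)] by blast
        then have "\<psi> q' y = \<zero>\<^bsub>K\<^esub>"
          using M(6)[OF le x(1)] y by (simp split: if_splits)
        then show ?thesis
          using M(7)[OF yc] by blast
      qed
      then show "y \<in> global_support K Qp \<tau> ?M q'"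
        using x(2) yc good_up[OF _ le] unfolding support by blast
    qed
  qed
  have meets: "\<exists>q. H q \<inter> global_support K Qp \<tau> ?M q \<noteq> {\<zero>\<^bsub>qpart ?M q\<^esub>}"
    if H: "qsubmodule K Qp H ?M" and nz: "H q \<noteq> {\<zero>\<^bsub>qpart ?M q\<^esub>}" for H q
  proof -
    have "submodule (H q) K (qpart ?M q)"
      using H by (simp add: qsubmodule_def)
    then have "\<zero>\<^bsub>qpart ?M q\<^esub> \<in> H q" and Hc: "H q \<subseteq> carrier (qpart ?M q)"
      using module.submoduleE(1)[OF M(2)] subgroup.one_closed[OF submodule.axioms(1)] by fastforce+
    then obtain x where x: "x \<in> H q" "x \<noteq> \<zero>\<^bsub>qpart ?M q\<^esub>" and xc: "x \<in> carrier (qpart ?M q)"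
      using nz by blast
    have "q \<in> P"
      using M(5)[OF _ xc] M(7)[OF xc] x(2) by blast
    then obtain s where s: "s \<in> P" "po_le Qp q s" "good s"
      using cop unfolding coprimary_downset_def good_def by blast
    let ?y = "qmor ?M q s x"
    have yc: "?y \<in> carrier (qpart ?M s)"
      by (rule M(3)[OF s(2) xc])
    have "?y \<noteq> \<zero>\<^bsub>qpart ?M s\<^esub>"
      using M(6)[OF s(2) xc] M(7)[OF yc] M(7)[OF xc] s(1) x(2) by simp
    moreover have "?y \<in> H s"
      using H s(2) x(1) unfolding qsubmodule_def by blast
    moreover have "?y \<in> global_support K Qp \<tau> ?M s"
      using yc s(3) by (simp add: support)
    ultimately show ?thesis
      by blast
  qed
  have "essential_qsubmodule K Qp (global_support K Qp \<tau> ?M) ?M"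
    unfolding essential_qsubmodule_def
  proof (intro conjI allI impI sub)
    fix H assume "qsubmodule K Qp H ?M" "\<exists>q. H q \<noteq> {\<zero>\<^bsub>qpart ?M q\<^esub>}"
    then show "\<exists>q. H q \<inter> global_support K Qp \<tau> ?M q \<noteq> {\<zero>\<^bsub>qpart ?M q\<^esub>}"
      by (elim exE) (rule meets)
  qed
  then show ?thesis
    using \<tau> inj unfolding coprimary_def by blast
qed

section \<open>Primary decomposition\<close>

lemma qhom_component:
  assumes hom: "qhom K Qp M (qdsum J E) \<phi>" and j: "j \<in> J"
  shows "qhom K Qp M (E j) (\<lambda>q x. \<phi> q x j)"
  unfolding qhom_def vs_hom_def
proof (intro conjI allI impI ballI CollectI funcsetI)
  have lin: "\<phi> q \<in> vs_hom K (qpart M q) (vs_dsum J (\<lambda>j. qpart (E j) q))" for q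
    using hom by (simp add: qhom_def qdsum_def)
  show "\<phi> q x j \<in> carrier (qpart (E j) q)" if "x \<in> carrier (qpart M q)" for q x
  proof -
    have "\<phi> q x \<in> carrier (vs_dsum J (\<lambda>j. qpart (E j) q))"
      using lin that unfolding vs_hom_def by blast
    then show ?thesis
      using j by (auto simp: vs_dsum_def)
  qed
  show "\<phi> q (x \<oplus>\<^bsub>qpart M q\<^esub> y) j = \<phi> q x j \<oplus>\<^bsub>qpart (E j) q\<^esub> \<phi> q y j"
    if "x \<in> carrier (qpart M q)" "y \<in> carrier (qpart M q)" for q x y
    using lin[of q] that j by (simp add: vs_hom_def vs_dsum_def)
  show "\<phi> q (c \<odot>\<^bsub>qpart M q\<^esub> x) j = c \<odot>\<^bsub>qpart (E j) q\<^esub> \<phi> q x j"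
    if "c \<in> carrier K" "x \<in> carrier (qpart M q)" for q c x
    using lin[of q] that j by (simp add: vs_hom_def vs_dsum_def)
  show "\<phi> q' (qmor M q q' x) j = qmor (E j) q q' (\<phi> q x j)"
    if "po_le Qp q q'" "x \<in> carrier (qpart M q)" for q q' x
    using hom that j by (simp add: qhom_def qdsum_def)
qed

lemma qhom_qdsum:
  assumes I: "finite I" and f: "\<And>i. i \<in> I \<Longrightarrow> qhom K Qp M (E i) (f i)"
  shows "qhom K Qp M (qdsum I E) (\<lambda>q x. \<lambda>i\<in>I. f i q x)"
  unfolding qhom_def vs_hom_def
proof (intro conjI allI impI ballI CollectI funcsetI)
  have lin: "f i q \<in> vs_hom K (qpart M q) (qpart (E i) q)" if "i \<in> I" for i q
    using f[OF that] by (simp add: qhom_def)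
  show "(\<lambda>i\<in>I. f i q x) \<in> carrier (qpart (qdsum I E) q)" if "x \<in> carrier (qpart M q)" for q x
  proof -
    have "f i q x \<in> carrier (qpart (E i) q)" if "i \<in> I" for i
      using lin[OF that, of q] \<open>x \<in> carrier (qpart M q)\<close> unfolding vs_hom_def by blast
    then show ?thesis
      using I by (simp add: qdsum_def vs_dsum_def)
  qed
  show "(\<lambda>i\<in>I. f i q (x \<oplus>\<^bsub>qpart M q\<^esub> y)) =
      (\<lambda>i\<in>I. f i q x) \<oplus>\<^bsub>qpart (qdsum I E) q\<^esub> (\<lambda>i\<in>I. f i q y)"
    if "x \<in> carrier (qpart M q)" "y \<in> carrier (qpart M q)" for q x y
    using lin[of _ q] that unfolding vs_hom_def qdsum_def vs_dsum_def
    by (simp cong: restrict_cong)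
  show "(\<lambda>i\<in>I. f i q (c \<odot>\<^bsub>qpart M q\<^esub> x)) = c \<odot>\<^bsub>qpart (qdsum I E) q\<^esub> (\<lambda>i\<in>I. f i q x)"
    if "c \<in> carrier K" "x \<in> carrier (qpart M q)" for q c x
    using lin[of _ q] that unfolding vs_hom_def qdsum_def vs_dsum_def
    by (simp cong: restrict_cong)
  show "(\<lambda>i\<in>I. f i q' (qmor M q q' x)) = qmor (qdsum I E) q q' (\<lambda>i\<in>I. f i q x)"
    if "po_le Qp q q'" "x \<in> carrier (qpart M q)" for q q' x
    using f that unfolding qhom_def qdsum_def by (simp cong: restrict_cong)
qed

text \<open>
  Composition of \<open>\<phi>\<close> with the quotient map from \<open>K[D]\<close> to \<open>K[P]\<close>.
\<close>
lemma (in po_group) qhom_restrict_downset: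
  assumes K: "cring K" and D: "downset Qp D" and P: "downset Qp P" "P \<subseteq> D"
    and hom: "qhom K Qp M (indicator_qmod K D) \<phi>"
  shows "qhom K Qp M (indicator_qmod K P) (\<lambda>q x. if q \<in> P then \<phi> q x else \<zero>\<^bsub>K\<^esub>)"
proof -
  interpret K: cring K by fact
  have "linear_form K (qpart M q) (\<lambda>x. if q \<in> P then \<phi> q x else \<zero>\<^bsub>K\<^esub>)" for q
    using hom unfolding qhom_downset_iff[OF D K] by (auto simp: linear_form_iff Pi_iff)
  moreover have "\<phi> q' (qmor M q q' x) = \<phi> q x" "q \<in> P"
    if "po_le Qp q q'" "x \<in> carrier (qpart M q)" "q' \<in> P" for q q' x
    using hom that P downsetD[OF P(1) that(1)] unfolding qhom_downset_iff[OF D K] by auto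
  ultimately show ?thesis
    unfolding qhom_downset_iff[OF P(1) K] by auto
qed

text \<open>
  The isomorphism theorem: \<open>M\<close> modulo the kernel of \<open>\<chi>\<close> embeds in the target of \<open>\<chi>\<close>.
\<close>
lemma (in po_group) qquot_kernel:
  assumes K: "cring K" and P: "downset Qp P" and M: "qmodule K Qp M"
    and \<chi>: "qhom K Qp M (indicator_qmod K P) \<chi>"
  defines "N \<equiv> \<lambda>q. form_kernel K (qpart M q) (\<chi> q)"
  shows "qsubmodule K Qp N M"
    and "downset_embedding K Qp (qquot M N) P (\<lambda>q X. the_elem (\<chi> q ` X))"
    and "qhom K Qp M (qquot M N) (qproj M N)"
    and "x \<in> carrier (qpart M q) \<Longrightarrow> the_elem (\<chi> q ` qproj M N q x) = \<chi> q x"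
proof -
  interpret K: cring K by fact
  have mod: "module K (qpart M q)" for q
    using M by (simp add: qmodule_def)
  have mor: "qmor M q q' x \<in> carrier (qpart M q')" if "po_le Qp q q'" "x \<in> carrier (qpart M q)" for q q' x
  proof -
    have "qmor M q q' \<in> vs_hom K (qpart M q) (qpart M q')"
      using M that(1) by (simp add: qmodule_def)
    then show ?thesis
      using that(2) by (auto simp: vs_hom_def)
  qed
  have lin: "linear_form K (qpart M q) (\<chi> q)"
    and out: "\<lbrakk>q \<notin> P; x \<in> carrier (qpart M q)\<rbrakk> \<Longrightarrow> \<chi> q x = \<zero>\<^bsub>K\<^esub>"
    and \<chi>_mor: "\<lbrakk>po_le Qp q q'; x \<in> carrier (qpart M q)\<rbrakk> \<Longrightarrow>
      \<chi> q' (qmor M q q' x) = (if q' \<in> P then \<chi> q x else \<zero>\<^bsub>K\<^esub>)" for q q' x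
    using \<chi> unfolding qhom_downset_iff[OF P K] by blast+
  have N: "N q = form_kernel K (qpart M q) (\<chi> q)" for q
    by (simp add: N_def)
  show "qsubmodule K Qp N M"
    using mor \<chi>_mor module.submodule_form_kernel[OF mod lin]
    by (auto simp: qsubmodule_def N form_kernel_def)
  note quot = qmodule_quotient_by_form_kernels[OF K P mod lin out mor \<chi>_mor po_le_refl po_le_trans N]
  show "downset_embedding K Qp (qquot M N) P (\<lambda>q X. the_elem (\<chi> q ` X))"
    unfolding qquot_def by (rule quot(1))
  note vq = vs_quot_form_kernel[OF mod lin, folded N]
  have "qmor (qquot M N) q q' (N q +>\<^bsub>qpart M q\<^esub> x) = N q' +>\<^bsub>qpart M q'\<^esub> qmor M q q' x"
    if "po_le Qp q q'" "x \<in> carrier (qpart M q)" for q q' x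
    unfolding qquot_def by (rule quot(3); (assumption | rule that))
  then show "qhom K Qp M (qquot M N) (qproj M N)"
    by (auto simp: qhom_def vs_hom_def qproj_def qquot_def vq)
  show "the_elem (\<chi> q ` qproj M N q x) = \<chi> q x" if "x \<in> carrier (qpart M q)" for q x
    unfolding qproj_def by (rule vq(5)[OF that])
qed

theorem theorem5p41:
  fixes K :: "('k, 'r) ring_scheme"
    and Qp :: "'q::ab_group_add set"
    and M :: "('q, 'k, 'v) qmod"
  assumes "field K"
    and "polyhedral_po_group Qp"
    and "qmodule K Qp M"
    and "downset_finite K Qp M"
  shows "\<exists>r N. primary_decomposition K Qp M r N"
proof -
  interpret polyhedral_po_group Qp by fact
  have K: "cring K"
    using assms(1) field.is_ring domain.axioms(1) field.axioms(1) by blast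
  obtain J :: "nat set" and D \<phi> where J: "finite J" and hull: "downset_hull K Qp M J D \<phi>"
    using assms(4) unfolding downset_finite_def by blast
  have D: "downset Qp (D j)" if "j \<in> J" for j
    using hull that by (simp add: downset_hull_def)
  have hom: "qhom K Qp M (indicator_qmod K (D j)) (\<lambda>q x. \<phi> q x j)" if "j \<in> J" for j
    using hull qhom_component[OF _ that] unfolding downset_hull_def by blast
  define I where "I = J \<times> {\<tau>. face Qp \<tau>}"
  define P where "P = (\<lambda>(j, \<tau>). coprimary_part Qp \<tau> (D j))"
  define \<chi> where "\<chi> = (\<lambda>(j, \<tau>) q x. if q \<in> P (j, \<tau>) then \<phi> q x j else \<zero>\<^bsub>K\<^esub>)"
  have "finite I"
    using J finite_faces by (simp add: I_def)
  then obtain e where e: "bij_betw e {0..<card I} I"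
    using ex_bij_betw_nat_finite by blast
  let ?r = "card I"
  have P: "coprimary_downset Qp \<tau> (P (j, \<tau>))" "downset Qp (P (j, \<tau>))"
    "qhom K Qp M (indicator_qmod K (P (j, \<tau>))) (\<chi> (j, \<tau>))" if "(j, \<tau>) \<in> I" for j \<tau>
  proof -
    have j: "j \<in> J" and \<tau>: "face Qp \<tau>"
      using that by (auto simp: I_def)
    show cop: "coprimary_downset Qp \<tau> (P (j, \<tau>))"
      using coprimary_downset_coprimary_part[OF D[OF j] \<tau>] by (simp add: P_def)
    then show down: "downset Qp (P (j, \<tau>))"
      by (simp add: coprimary_downset_def)
    have "P (j, \<tau>) \<subseteq> D j"
      using coprimary_part_subset[OF D[OF j] \<tau>] by (simp add: P_def)
    then show "qhom K Qp M (indicator_qmod K (P (j, \<tau>))) (\<chi> (j, \<tau>))"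
      using qhom_restrict_downset[OF K D[OF j] down _ hom[OF j]] by (simp add: \<chi>_def)
  qed
  define N where "N = (\<lambda>i q. form_kernel K (qpart M q) (\<chi> (e i) q))"
  have eI: "e i \<in> I" if "i < ?r" for i
    using e that by (auto simp: bij_betw_def)
  have comp: "qsubmodule K Qp (N i) M" "coprimary K Qp (qquot M (N i))"
    "qhom K Qp M (qquot M (N i)) (qproj M (N i))"
    "\<And>q x. x \<in> carrier (qpart M q) \<Longrightarrow> the_elem (\<chi> (e i) q ` qproj M (N i) q x) = \<chi> (e i) q x"
    if i: "i < ?r" for i
  proof -
    obtain j \<tau> where ei: "e i = (j, \<tau>)"
      by fastforce
    have \<tau>: "face Qp \<tau>"
      using eI[OF i] ei by (simp add: I_def)
    note Pi = P[OF eI[OF i, unfolded ei]]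
    note quot = qquot_kernel[OF K Pi(2) assms(3) Pi(3), folded ei, folded N_def]
    show "qsubmodule K Qp (N i) M" "qhom K Qp M (qquot M (N i)) (qproj M (N i))"
      using quot(1,3) unfolding N_def .
    show "coprimary K Qp (qquot M (N i))"
      using coprimary_if_downset_embedding[OF K quot(2) \<tau>] Pi(1) unfolding N_def ei by blast
    show "\<And>q x. x \<in> carrier (qpart M q) \<Longrightarrow> the_elem (\<chi> (e i) q ` qproj M (N i) q x) = \<chi> (e i) q x"
      using quot(4) unfolding N_def .
  qed
  have inj: "x = y" if x: "x \<in> carrier (qpart M q)" and y: "y \<in> carrier (qpart M q)"
    and eq: "\<And>i. i < ?r \<Longrightarrow> qproj M (N i) q x = qproj M (N i) q y" for q x y
  proof -
    have \<chi>eq: "\<chi> (j, \<tau>) q x = \<chi> (j, \<tau>) q y" if jt: "(j, \<tau>) \<in> I" for j \<tau>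
    proof -
      obtain i where "i < ?r" "e i = (j, \<tau>)"
        using e jt by (metis atLeastLessThan_iff bij_betw_iff_bijections)
      then show ?thesis
        using comp(4)[of i x q] comp(4)[of i y q] x y eq[of i] by simp
    qed
    have "\<phi> q x j = \<phi> q y j" if j: "j \<in> J" for j
    proof (cases "q \<in> D j")
      case True
      then obtain \<tau> where "face Qp \<tau>" "q \<in> P (j, \<tau>)"
        using downset_eq_Union_coprimary_part[OF D[OF j]] by (auto simp: P_def)
      then show ?thesis
        using \<chi>eq[of j \<tau>] j by (simp add: \<chi>_def I_def)
    next
      case False
      then show ?thesis
        using hom[OF j] x y unfolding qhom_downset_iff[OF D[OF j] K] by simp
    qed
    moreover have "\<phi> q z \<in> extensional J" if "z \<in> carrier (qpart M q)" for z
      using hull that by (auto simp: downset_hull_def qhom_def qdsum_def vs_hom_def vs_dsum_def PiE_def)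
    ultimately have "\<phi> q x = \<phi> q y"
      using x y by (intro extensionalityI[of "\<phi> q x" J "\<phi> q y"]) auto
    moreover have "inj_on (\<phi> q) (carrier (qpart M q))"
      using hull by (simp add: downset_hull_def qinjective_def)
    ultimately show ?thesis
      using x y by (auto dest: inj_onD)
  qed
  let ?f = "\<lambda>q x. \<lambda>i\<in>{..<?r}. qproj M (N i) q x"
  have "qhom K Qp M (qdsum {..<?r} (\<lambda>i. qquot M (N i))) ?f"
    using comp(3) by (intro qhom_qdsum) auto
  moreover have "qinjective M ?f"
    unfolding qinjective_def
  proof (intro allI inj_onI)
    fix q x y assume xy: "x \<in> carrier (qpart M q)" "y \<in> carrier (qpart M q)" and eq: "?f q x = ?f q y"
    have "qproj M (N i) q x = qproj M (N i) q y" if "i < ?r" for i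
      using fun_cong[OF eq, of i] that by simp
    then show "x = y"
      using inj xy by blast
  qed
  ultimately have "primary_decomposition K Qp M ?r N"
    using comp(1,2) by (simp add: primary_decomposition_def Let_def)
  then show ?thesis
    by blast
qed

end
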